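(* Let $S$ be a matrix set which contains no empty matrix and let $N\in\mathsf{matr}(n,m,k)$, where $n,k>0$ and $m\geqslant 0$ are integers. The following statements are equivalent: (1) $\mathsf{mclex}\,S\subseteq\mathsf{mclex}\{N\}$. (2) The category $(\mathsf{Inj}_S\mathbf{Rel}_n)^{\mathsf{op}}$, which belongs to $\mathsf{mclex}\,S$, also belongs to $\mathsf{mclex}\{N\}$.
   Context: Matrices. For integers $n,k>0$ and $m\geqslant 0$, $\mathsf{matr}(n,m,k)$ is the set of $n\times m$ matrices with entries in $\{0,\dots,k-1\}$ ($m=0$ is allowed; such matrices are called empty). A matrix set is a subset of $\bigcup_{n>0,m\geqslant 0,k>0}\mathsf{matr}(n,m,k)$. Interpretations. An interpretation of $M=[a_{ij}]\in\mathsf{matr}(n,m,k)$ of type $S$ (a set) is given by a function $f\colon\{0,\dots,k-1\}\to S$; it is the $n\times m$ matrix $[f(a_{ij})]$, whose columns are called left columns, extended by the right column with $n$ entries all equal to $f(0)$. Closedness in categories. An internal $n$-ary relation on an object $C$ of a category $\mathbb{C}$ is an object $R$ with jointly monic morphisms $r_1,\dots,r_n\colon R\to C$. An element $(g_1,\dots,g_n)$ of $\mathbb{C}(X,C)^n$ belongs to the relation (over $X$) if there is $u\colon X\to R$ with $r_iu=g_i$ for all $i$. For $M$ with $n$ rows, the relation is $M$-closed over an object $X$ if for every interpretation of $M$ of type $\mathbb{C}(X,C)$ all of whose left columns belong to the relation over $X$, the right column also belongs to the relation over $X$; it is $M$-closed if it is $M$-closed over every object $X$. A category has $M$-closed relations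 if every internal $n$-ary relation on any object in it is $M$-closed. $\mathsf{mclex}\,S$ is the collection of all finitely complete categories having $M$-closed relations for every $M\in S$. Injectivity. For a matrix set $S$, an object $X$ of a category $\mathbb{C}$ is $S$-injective if for every $M\in S$, with $n$ rows say, every internal $n$-ary relation on any object in $\mathbb{C}^{\mathsf{op}}$ is $M$-closed over $X$. $\mathsf{Inj}_S\mathbb{C}$ is the full subcategory of $\mathbb{C}$ of all $S$-injective objects. $\mathbf{Rel}_n$ is the category whose objects are pairs $(X,R)$ with $X$ a set and $R\subseteq X^n$, and whose morphisms $(X,R)\to(X',R')$ are functions $f\colon X\to X'$ with $f^n(R)\subseteq R'$. *)

theory Defs
  imports
    "Jordan_Normal_Form.Matrix"
    "HOL-Library.Equipollence"
    "HOL-Library.FuncSet"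
begin

section \<open>Matrices and their interpretations\<close>

definition matr :: "nat \<Rightarrow> nat \<Rightarrow> nat \<Rightarrow> nat mat set" where
  "matr n m k = {M \<in> carrier_mat n m. \<forall>i<n. \<forall>j<m. M $$ (i, j) < k}"

definition matrix_set :: "nat mat set \<Rightarrow> bool" where
  "matrix_set S \<longleftrightarrow> S \<subseteq> (\<Union>n\<in>{0<..}. \<Union>m. \<Union>k\<in>{0<..}. matr n m k)"

definition empty_matrix :: "nat mat \<Rightarrow> bool" where
  "empty_matrix M \<longleftrightarrow> dim_col M = 0"

text \<open>An interpretation is the pair consisting of the matrix of left columns and the right column.
  The bound \<open>k\<close> is not determined by the matrix \<open>M\<close> (the sets \<open>matr n m k\<close> grow with \<open>k\<close>), so every
  admissible positive \<open>k\<close> is allowed. Positivity makes \<open>f 0\<close> an element of \<open>T\<close>, also when \<open>M\<close> is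
  empty.\<close>

definition interpretations :: "nat mat \<Rightarrow> 'a set \<Rightarrow> ('a mat \<times> 'a vec) set" where
  "interpretations M T =
     {(map_mat f M, vec (dim_row M) (\<lambda>_. f 0)) | f k.
        k > 0 \<and> M \<in> matr (dim_row M) (dim_col M) k \<and> f \<in> {..<k} \<rightarrow> T}"


section \<open>Categories\<close>

record ('o, 'm) cat =
  Ob :: "'o set"
  Arr :: "'m set"
  Dom :: "'m \<Rightarrow> 'o"
  Cod :: "'m \<Rightarrow> 'o"
  Ident :: "'o \<Rightarrow> 'm"
  Comp :: "'m \<Rightarrow> 'm \<Rightarrow> 'm"

text \<open>\<open>Comp C g f\<close> is the composite ``\<open>g\<close> after \<open>f\<close>''.\<close>

definition Hom :: "('o, 'm) cat \<Rightarrow> 'o \<Rightarrow> 'o \<Rightarrow> 'm set" where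
  "Hom C X Y = {f \<in> Arr C. Dom C f = X \<and> Cod C f = Y}"

locale category =
  fixes C :: "('o, 'm) cat"
  assumes Dom_Ob: "f \<in> Arr C \<Longrightarrow> Dom C f \<in> Ob C"
    and Cod_Ob: "f \<in> Arr C \<Longrightarrow> Cod C f \<in> Ob C"
    and Ident_Hom: "X \<in> Ob C \<Longrightarrow> Ident C X \<in> Hom C X X"
    and Comp_Hom: "f \<in> Hom C X Y \<Longrightarrow> g \<in> Hom C Y Z \<Longrightarrow> Comp C g f \<in> Hom C X Z"
    and Comp_Ident_left: "f \<in> Hom C X Y \<Longrightarrow> Comp C (Ident C Y) f = f"
    and Comp_Ident_right: "f \<in> Hom C X Y \<Longrightarrow> Comp C f (Ident C X) = f"
    and Comp_assoc: "f \<in> Hom C W X \<Longrightarrow> g \<in> Hom C X Y \<Longrightarrow> h \<in> Hom C Y Z \<Longrightarrow>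
      Comp C h (Comp C g f) = Comp C (Comp C h g) f"

definition dual :: "('o, 'm) cat \<Rightarrow> ('o, 'm) cat" where
  "dual C = \<lparr>Ob = Ob C, Arr = Arr C, Dom = Cod C, Cod = Dom C, Ident = Ident C,
     Comp = (\<lambda>g f. Comp C f g)\<rparr>"

definition full_subcategory :: "('o, 'm) cat \<Rightarrow> 'o set \<Rightarrow> ('o, 'm) cat" where
  "full_subcategory C A = \<lparr>Ob = Ob C \<inter> A, Arr = {f \<in> Arr C. Dom C f \<in> A \<and> Cod C f \<in> A},
     Dom = Dom C, Cod = Cod C, Ident = Ident C, Comp = Comp C\<rparr>"


section \<open>Finite completeness\<close>

definition is_functor ::
    "('i, 'j) cat \<Rightarrow> ('o, 'm) cat \<Rightarrow> ('i \<Rightarrow> 'o) \<Rightarrow> ('j \<Rightarrow> 'm) \<Rightarrow> bool" where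
  "is_functor J C Fo Fa \<longleftrightarrow>
     (\<forall>i\<in>Ob J. Fo i \<in> Ob C) \<and>
     (\<forall>a\<in>Arr J. Fa a \<in> Hom C (Fo (Dom J a)) (Fo (Cod J a))) \<and>
     (\<forall>i\<in>Ob J. Fa (Ident J i) = Ident C (Fo i)) \<and>
     (\<forall>a\<in>Arr J. \<forall>b\<in>Arr J. Cod J a = Dom J b \<longrightarrow> Fa (Comp J b a) = Comp C (Fa b) (Fa a))"

definition is_cone ::
    "('i, 'j) cat \<Rightarrow> ('o, 'm) cat \<Rightarrow> ('i \<Rightarrow> 'o) \<Rightarrow> ('j \<Rightarrow> 'm) \<Rightarrow> 'o \<Rightarrow> ('i \<Rightarrow> 'm) \<Rightarrow> bool" where
  "is_cone J C Fo Fa L p \<longleftrightarrow>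
     L \<in> Ob C \<and>
     (\<forall>i\<in>Ob J. p i \<in> Hom C L (Fo i)) \<and>
     (\<forall>a\<in>Arr J. Comp C (Fa a) (p (Dom J a)) = p (Cod J a))"

definition is_limit ::
    "('i, 'j) cat \<Rightarrow> ('o, 'm) cat \<Rightarrow> ('i \<Rightarrow> 'o) \<Rightarrow> ('j \<Rightarrow> 'm) \<Rightarrow> 'o \<Rightarrow> ('i \<Rightarrow> 'm) \<Rightarrow> bool" where
  "is_limit J C Fo Fa L p \<longleftrightarrow>
     is_cone J C Fo Fa L p \<and>
     (\<forall>L' p'. is_cone J C Fo Fa L' p' \<longrightarrow>
        (\<exists>!u. u \<in> Hom C L' L \<and> (\<forall>i\<in>Ob J. Comp C (p i) u = p' i)))"

text \<open>Every finite category is isomorphic to one whose objects and arrows are natural numbers, so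
  it suffices to consider shapes of type \<open>(nat, nat) cat\<close>.\<close>

definition finitely_complete :: "('o, 'm) cat \<Rightarrow> bool" where
  "finitely_complete C \<longleftrightarrow> category C \<and>
     (\<forall>(J :: (nat, nat) cat) Fo Fa.
        category J \<and> finite (Ob J) \<and> finite (Arr J) \<and> is_functor J C Fo Fa \<longrightarrow>
        (\<exists>L p. is_limit J C Fo Fa L p))"


section \<open>Internal relations and closedness\<close>

text \<open>An internal relation on \<open>A\<close> is given by an object \<open>R\<close> and the vector \<open>r\<close> of its legs
  \<open>R \<rightarrow> A\<close>; its arity is the dimension of \<open>r\<close>.\<close>

definition internal_relation ::
    "('o, 'm) cat \<Rightarrow> nat \<Rightarrow> 'o \<Rightarrow> 'o \<Rightarrow> 'm vec \<Rightarrow> bool" where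
  "internal_relation C n A R r \<longleftrightarrow>
     A \<in> Ob C \<and> R \<in> Ob C \<and> r \<in> carrier_vec n \<and> (\<forall>i<n. r $ i \<in> Hom C R A) \<and>
     (\<forall>X\<in>Ob C. \<forall>u\<in>Hom C X R. \<forall>v\<in>Hom C X R.
        (\<forall>i<n. Comp C (r $ i) u = Comp C (r $ i) v) \<longrightarrow> u = v)"

definition belongs :: "('o, 'm) cat \<Rightarrow> 'o \<Rightarrow> 'm vec \<Rightarrow> 'o \<Rightarrow> 'm vec \<Rightarrow> bool" where
  "belongs C R r X g \<longleftrightarrow> (\<exists>u\<in>Hom C X R. \<forall>i<dim_vec r. Comp C (r $ i) u = g $ i)"

definition closed_over ::
    "('o, 'm) cat \<Rightarrow> nat mat \<Rightarrow> 'o \<Rightarrow> 'o \<Rightarrow> 'm vec \<Rightarrow> 'o \<Rightarrow> bool" where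
  "closed_over C M A R r X \<longleftrightarrow>
     (\<forall>(B, v) \<in> interpretations M (Hom C X A).
        (\<forall>j<dim_col B. belongs C R r X (col B j)) \<longrightarrow> belongs C R r X v)"

definition has_closed_relations :: "('o, 'm) cat \<Rightarrow> nat mat \<Rightarrow> bool" where
  "has_closed_relations C M \<longleftrightarrow>
     (\<forall>A R r. internal_relation C (dim_row M) A R r \<longrightarrow> (\<forall>X\<in>Ob C. closed_over C M A R r X))"

definition mclex :: "nat mat set \<Rightarrow> ('o, 'm) cat set" where
  "mclex S = {C. finitely_complete C \<and> (\<forall>M\<in>S. has_closed_relations C M)}"

definition injective_object :: "('o, 'm) cat \<Rightarrow> nat mat set \<Rightarrow> 'o \<Rightarrow> bool" where
  "injective_object C S X \<longleftrightarrow> X \<in> Ob C \<and>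
     (\<forall>M\<in>S. \<forall>A R r. internal_relation (dual C) (dim_row M) A R r \<longrightarrow>
        closed_over (dual C) M A R r X)"

definition Inj :: "nat mat set \<Rightarrow> ('o, 'm) cat \<Rightarrow> ('o, 'm) cat" where
  "Inj S C = full_subcategory C {X. injective_object C S X}"


section \<open>Sets with an n-ary relation\<close>

text \<open>The collection \<open>U\<close> plays the role of the class of all (small) sets: a collection of sets, with
  elements drawn from some type, that contains an infinite set and is closed under subsets, images
  and binary unions. Examples are the collection of all subsets of an arbitrary infinite type and,
  if the type carries a model of set theory, the collection of the extensions of its elements.\<close>

definition set_universe :: "'u set set \<Rightarrow> bool" where
  "set_universe U \<longleftrightarrow>
     (\<exists>X\<in>U. infinite X) \<and>
     (\<forall>X\<in>U. \<forall>Y. Y \<subseteq> X \<longrightarrow> Y \<in> U) \<and>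
     (\<forall>X\<in>U. \<forall>f :: 'u \<Rightarrow> 'u. f ` X \<in> U) \<and>
     (\<forall>X\<in>U. \<forall>Y\<in>U. X \<union> Y \<in> U)"

definition tuples :: "nat \<Rightarrow> 'u set \<Rightarrow> 'u vec set" where
  "tuples n X = {x \<in> carrier_vec n. \<forall>i<n. x $ i \<in> X}"

type_synonym 'u rel_ob = "'u set \<times> 'u vec set"
type_synonym 'u rel_arr = "'u rel_ob \<times> ('u \<Rightarrow> 'u) \<times> 'u rel_ob"

text \<open>A morphism is a triple of its domain, its underlying function and its codomain; the underlying
  function is extensional, so that equality of morphisms is equality of functions on the domain.\<close>

definition Rel :: "'u set set \<Rightarrow> nat \<Rightarrow> ('u rel_ob, 'u rel_arr) cat" where
  "Rel U n = \<lparr>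
     Ob = {(X, R). X \<in> U \<and> R \<subseteq> tuples n X},
     Arr = {((X, R), f, (X', R')) | X R f X' R'.
              X \<in> U \<and> R \<subseteq> tuples n X \<and> X' \<in> U \<and> R' \<subseteq> tuples n X' \<and>
              f \<in> X \<rightarrow>\<^sub>E X' \<and> map_vec f ` R \<subseteq> R'},
     Dom = (\<lambda>(P, f, Q). P),
     Cod = (\<lambda>(P, f, Q). Q),
     Ident = (\<lambda>(X, R). ((X, R), restrict id X, (X, R))),
     Comp = (\<lambda>(Q, g, P') (P, f, Q'). (P, compose (fst P) g f, P'))\<rparr>"

end

(* For a matrix M and a finitely complete category with M-closed relations, every internal relation on
   A is also closed, over each Y, under the tuples obtained by choosing a row of M separately for each
   coordinate and a family of k elements of Hom(Y, A) separately for each coordinate: apply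
   M-closedness to a suitable relation on a power of A. The S-injective objects of Rel_n are exactly the
   pairs (X, R) for which R and the equality of X are closed in this sense. These Horn conditions pass
   to substructures and products, so every set of maps from a fixed set to S-injective
   objects has a universal quotient, which gives colimits and free objects. They also show that for a relation R on A in a
   category of mclex S, each finite subset of Hom(Y, A), with the relation induced by R, is S-injective.
   Closedness under N of the generic n-ary relation in the dual of the S-injective objects, tested over
   this finite structure, is closedness of R under N. *)
theory Submission
  imports Defs
begin

section \<open>Isomorphic categories and finite limits\<close>

text \<open>Closedness of equality accompanies closedness of \<open>R\<close> because injectivity is
  an extension problem: along jointly surjective maps \<open>\<rho> i\<close> from \<open>B\<close>
  to \<open>Q\<close>, a function on \<open>Q\<close> is prescribed by its values at the points
  \<open>\<rho> i b\<close>. Closedness of equality makes these values consistent, and closedness of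
  \<open>R\<close> makes the resulting function a morphism. This rests on jointly epic maps being
  jointly surjective. In \<open>Rel\<close> a set with at least two points and all tuples detects
  that. Among the S-injective objects such a set may be missing, and then all of them have at most
  one point; nonemptiness of the matrices in \<open>S\<close> settles this degenerate case. Two
  questions of size shape the constructions. A product of all targets could leave the universe, so
  quotients are built directly on representatives in a given set. An interpretation involves at most
  \<open>k\<close> morphisms, so a finite structure coded by natural numbers can stand for the
  hom-set, however large the category is.\<close>

lemma Hom_iff: "f \<in> Hom C X Y \<longleftrightarrow> f \<in> Arr C \<and> Dom C f = X \<and> Cod C f = Y"
  by (simp add: Hom_def)

lemma (in category) Hom_Ob:
  assumes "f \<in> Hom C X Y"
  shows "X \<in> Ob C" "Y \<in> Ob C"
  using assms Dom_Ob Cod_Ob by (auto simp: Hom_iff)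

lemma dual_simps [simp]:
  "Ob (dual C) = Ob C" "Arr (dual C) = Arr C" "Dom (dual C) = Cod C" "Cod (dual C) = Dom C"
  "Ident (dual C) = Ident C" "Comp (dual C) g f = Comp C f g" "Hom (dual C) X Y = Hom C Y X"
  by (auto simp: dual_def Hom_def)

lemma category_dual:
  assumes "category C"
  shows "category (dual C)"
proof -
  interpret category C by fact
  show ?thesis
    by unfold_locales
      (auto intro: Dom_Ob Cod_Ob Ident_Hom Comp_Hom Comp_Ident_left Comp_Ident_right Comp_assoc[symmetric])
qed

lemma full_subcategory_simps [simp]:
  "Ob (full_subcategory C A) = Ob C \<inter> A"
  "Dom (full_subcategory C A) = Dom C" "Cod (full_subcategory C A) = Cod C"
  "Ident (full_subcategory C A) = Ident C" "Comp (full_subcategory C A) = Comp C"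
  by (simp_all add: full_subcategory_def)

lemma Hom_full_subcategory [simp]:
  "X \<in> A \<Longrightarrow> Y \<in> A \<Longrightarrow> Hom (full_subcategory C A) X Y = Hom C X Y"
  by (auto simp: full_subcategory_def Hom_def)

lemma Hom_full_subcategory_subset:
  "f \<in> Hom (full_subcategory C A) X Y \<Longrightarrow> X \<in> A \<and> Y \<in> A \<and> f \<in> Hom C X Y"
  by (auto simp: full_subcategory_def Hom_def)

lemma full_subcategory_UNIV [simp]: "full_subcategory C UNIV = C"
  by (cases C) (simp add: full_subcategory_def)

lemma category_full_subcategory:
  assumes "category C"
  shows "category (full_subcategory C A)"
proof -
  interpret category C by fact
  show ?thesis
  proof
    fix f assume "f \<in> Arr (full_subcategory C A)"
    then show "Dom (full_subcategory C A) f \<in> Ob (full_subcategory C A)"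
      "Cod (full_subcategory C A) f \<in> Ob (full_subcategory C A)"
      using Dom_Ob Cod_Ob by (auto simp: full_subcategory_def)
  next
    fix X assume "X \<in> Ob (full_subcategory C A)"
    then show "Ident (full_subcategory C A) X \<in> Hom (full_subcategory C A) X X"
      using Ident_Hom by auto
  next
    fix f g X Y Z
    assume "f \<in> Hom (full_subcategory C A) X Y" "g \<in> Hom (full_subcategory C A) Y Z"
    then show "Comp (full_subcategory C A) g f \<in> Hom (full_subcategory C A) X Z"
      by (auto dest!: Hom_full_subcategory_subset intro: Comp_Hom)
  qed (auto dest!: Hom_full_subcategory_subset intro: Comp_Ident_left Comp_Ident_right Comp_assoc)
qed

section \<open>Transport of finite limits and closed relations along isomorphisms of
  categories\<close>

locale cat_iso =
  C: category C + D: category D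
  for C :: "('o, 'm) cat" and D :: "('p, 'q) cat" +
  fixes g :: "'o \<Rightarrow> 'p" and h :: "'m \<Rightarrow> 'q" and g' :: "'p \<Rightarrow> 'o" and h' :: "'q \<Rightarrow> 'm"
  assumes Ob_map: "X \<in> Ob C \<Longrightarrow> g X \<in> Ob D \<and> g' (g X) = X"
    and Ob_map': "V \<in> Ob D \<Longrightarrow> g' V \<in> Ob C \<and> g (g' V) = V"
    and Hom_map: "f \<in> Hom C X Y \<Longrightarrow> h f \<in> Hom D (g X) (g Y) \<and> h' (h f) = f"
    and Hom_map': "l \<in> Hom D V W \<Longrightarrow> h' l \<in> Hom C (g' V) (g' W) \<and> h (h' l) = l"
    and Ident_map: "X \<in> Ob C \<Longrightarrow> h (Ident C X) = Ident D (g X)"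
    and Comp_map: "f \<in> Hom C X Y \<Longrightarrow> k \<in> Hom C Y Z \<Longrightarrow> h (Comp C k f) = Comp D (h k) (h f)"
begin

lemma Ident_map': "Y \<in> Ob D \<Longrightarrow> h' (Ident D Y) = Ident C (g' Y)"
  using Ob_map' Ident_map Hom_map C.Ident_Hom by metis

lemma Comp_map':
  assumes "f \<in> Hom D X Y" "k \<in> Hom D Y Z"
  shows "h' (Comp D k f) = Comp C (h' k) (h' f)"
  using assms Hom_map' Comp_map Hom_map C.Comp_Hom by metis

lemma inverse: "cat_iso D C g' h' g h"
  by unfold_locales (use Ob_map Ob_map' Hom_map Hom_map' Ident_map' Comp_map' in auto)

lemma is_functor_map:
  assumes "is_functor J C Fo Fa" and J: "category J"
  shows "is_functor J D (g \<circ> Fo) (h \<circ> Fa)"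
  unfolding is_functor_def
proof (intro conjI ballI impI)
  fix a b assume "a \<in> Arr J" "b \<in> Arr J" "Cod J a = Dom J b"
  then have "Fa (Comp J b a) = Comp C (Fa b) (Fa a)"
    and "Fa a \<in> Hom C (Fo (Dom J a)) (Fo (Cod J a))" "Fa b \<in> Hom C (Fo (Cod J a)) (Fo (Cod J b))"
    using assms by (auto simp: is_functor_def)
  then show "(h \<circ> Fa) (Comp J b a) = Comp D ((h \<circ> Fa) b) ((h \<circ> Fa) a)"
    using Comp_map by simp
qed (use assms Ob_map Hom_map Ident_map in \<open>auto simp: is_functor_def\<close>)

lemma is_cone_map:
  assumes F: "is_functor J C Fo Fa" and J: "category J" and p: "is_cone J C Fo Fa L p"
  shows "is_cone J D (g \<circ> Fo) (h \<circ> Fa) (g L) (h \<circ> p)"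
  unfolding is_cone_def
proof (intro conjI ballI)
  fix a assume a: "a \<in> Arr J"
  then have "Dom J a \<in> Ob J" "Cod J a \<in> Ob J"
    using J category.Dom_Ob category.Cod_Ob by metis+
  then have "p (Dom J a) \<in> Hom C L (Fo (Dom J a))" "Fa a \<in> Hom C (Fo (Dom J a)) (Fo (Cod J a))"
    and "Comp C (Fa a) (p (Dom J a)) = p (Cod J a)"
    using F p a by (auto simp: is_functor_def is_cone_def)
  then show "Comp D ((h \<circ> Fa) a) ((h \<circ> p) (Dom J a)) = (h \<circ> p) (Cod J a)"
    using Comp_map by (metis comp_apply)
qed (use p Ob_map Hom_map in \<open>auto simp: is_cone_def\<close>)

end

lemma is_cone_cong:
  assumes "category J" "\<And>i. i \<in> Ob J \<Longrightarrow> Fo i = Fo' i" "\<And>a. a \<in> Arr J \<Longrightarrow> Fa a = Fa' a"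
    "\<And>i. i \<in> Ob J \<Longrightarrow> p i = p' i" "is_cone J C Fo Fa L p"
  shows "is_cone J C Fo' Fa' L p'"
  using assms category.Dom_Ob[of J] category.Cod_Ob[of J] unfolding is_cone_def by auto

text \<open>A diagram in \<open>D\<close> is pulled back along the inverse isomorphism and its limit
  is pushed forward again. The round trip agrees with \<open>Fo\<close> and \<open>Fa\<close> only
  on the objects and arrows of \<open>J\<close>, which is why \<open>is_cone_cong\<close> is
  needed.\<close>

lemma (in cat_iso) finitely_complete_map:
  assumes "finitely_complete C"
  shows "finitely_complete D"
  unfolding finitely_complete_def
proof (intro conjI allI impI)
  show "category D" by unfold_locales
  interpret inv: cat_iso D C g' h' g h by (rule inverse)
  fix J :: "(nat, nat) cat" and Fo Fa
  assume *: "category J \<and> finite (Ob J) \<and> finite (Arr J) \<and> is_functor J D Fo Fa"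
  then have J: "category J" and F: "is_functor J D Fo Fa" by auto
  have F': "is_functor J C (g' \<circ> Fo) (h' \<circ> Fa)"
    using inv.is_functor_map[OF F J] .
  then obtain L p where L: "is_limit J C (g' \<circ> Fo) (h' \<circ> Fa) L p"
    using assms * unfolding finitely_complete_def by blast
  then have cone: "is_cone J C (g' \<circ> Fo) (h' \<circ> Fa) L p"
    by (simp add: is_limit_def)
  have Fo: "g (g' (Fo i)) = Fo i" if "i \<in> Ob J" for i
    using F that Ob_map' by (auto simp: is_functor_def)
  have Fa: "h (h' (Fa i)) = Fa i" if "i \<in> Arr J" for i
    using F that Hom_map' by (auto simp: is_functor_def)
  have "is_limit J D Fo Fa (g L) (h \<circ> p)"
    unfolding is_limit_def
  proof (intro conjI allI impI)
    show "is_cone J D Fo Fa (g L) (h \<circ> p)"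
      by (rule is_cone_cong[OF J _ _ _ is_cone_map[OF F' J cone]]) (auto simp: Fo Fa)
  next
    fix L' p' assume c': "is_cone J D Fo Fa L' p'"
    have pHom: "p i \<in> Hom C L (g' (Fo i))" and p'Hom: "p' i \<in> Hom D L' (Fo i)"
      if "i \<in> Ob J" for i
      using cone c' that by (auto simp: is_cone_def)
    have L': "L' \<in> Ob D" and LOb: "L \<in> Ob C" using c' cone by (auto simp: is_cone_def)
    have ex1: "\<exists>!u. u \<in> Hom C (g' L') L \<and> (\<forall>i\<in>Ob J. Comp C (p i) u = h' (p' i))"
    proof -
      have "\<exists>!u. u \<in> Hom C (g' L') L \<and> (\<forall>i\<in>Ob J. Comp C (p i) u = (h' \<circ> p') i)"
        using inv.is_cone_map[OF F J c'] L unfolding is_limit_def by blast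
      then show ?thesis by simp
    qed
    have transfer: "Comp D (h (p i)) v = p' i \<longleftrightarrow> Comp C (p i) (h' v) = h' (p' i)"
      if "i \<in> Ob J" "v \<in> Hom D L' (g L)" for i v
    proof -
      have v: "h' v \<in> Hom C (g' L') L" "h (h' v) = v"
        using Hom_map'[OF that(2)] Ob_map[OF LOb] by auto
      have "h (Comp C (p i) (h' v)) = Comp D (h (p i)) v"
        using Comp_map[OF v(1) pHom[OF that(1)]] v(2) by simp
      then show ?thesis
        using Hom_map C.Comp_Hom[OF v(1) pHom[OF that(1)]] Hom_map' p'Hom[OF that(1)] by metis
    qed
    from ex1 obtain u where u: "u \<in> Hom C (g' L') L" "\<forall>i\<in>Ob J. Comp C (p i) u = h' (p' i)"
      by blast
    show "\<exists>!u. u \<in> Hom D L' (g L) \<and> (\<forall>i\<in>Ob J. Comp D ((h \<circ> p) i) u = p' i)"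
    proof (intro ex1I conjI ballI)
      show hu: "h u \<in> Hom D L' (g L)"
        using Hom_map[OF u(1)] Ob_map'[OF L'] by simp
      show "Comp D ((h \<circ> p) i) (h u) = p' i" if "i \<in> Ob J" for i
        using transfer[OF that hu] Hom_map[OF u(1)] u(2) that by simp
    next
      fix v assume v: "v \<in> Hom D L' (g L) \<and> (\<forall>i\<in>Ob J. Comp D ((h \<circ> p) i) v = p' i)"
      then have "h' v \<in> Hom C (g' L') L" "\<forall>i\<in>Ob J. Comp C (p i) (h' v) = h' (p' i)"
        using transfer Hom_map'[of v L' "g L"] Ob_map[OF LOb] by auto
      with u ex1 have "h' v = u" by blast
      then show "v = h u" using Hom_map' v by metis
    qed
  qed
  then show "\<exists>L p. is_limit J D Fo Fa L p" by blast
qed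

text \<open>\<open>belongs\<close> ranges over the dimension of \<open>r\<close>, while the columns
  of an interpretation have \<open>dim_row M\<close> entries; the hypothesis matches the two and
  lets the pair of matrix and vector be replaced by the function \<open>f\<close>.\<close>

lemma closed_over_iff:
  assumes "dim_vec r = dim_row M"
  shows "closed_over C M A R r X \<longleftrightarrow>
    (\<forall>k>0. \<forall>f\<in>{..<k} \<rightarrow> Hom C X A. M \<in> matr (dim_row M) (dim_col M) k \<longrightarrow>
      (\<forall>j<dim_col M. \<exists>u\<in>Hom C X R. \<forall>i<dim_row M. Comp C (r $ i) u = f (M $$ (i, j))) \<longrightarrow>
      (\<exists>u\<in>Hom C X R. \<forall>i<dim_row M. Comp C (r $ i) u = f 0))"
  (is "_ \<longleftrightarrow> (\<forall>k>0. \<forall>f\<in>_. _ \<longrightarrow> ?P f \<longrightarrow> ?Q f)")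
proof -
  have P: "(\<forall>j<dim_col (map_mat f M). belongs C R r X (col (map_mat f M) j)) \<longleftrightarrow> ?P f" for f
    by (simp add: belongs_def assms)
  have Q: "belongs C R r X (vec (dim_row M) (\<lambda>_. f 0)) \<longleftrightarrow> ?Q f" for f :: "nat \<Rightarrow> _"
    by (simp add: belongs_def assms)
  have "closed_over C M A R r X \<longleftrightarrow> (\<forall>f k. k > 0 \<and> M \<in> matr (dim_row M) (dim_col M) k \<and>
      f \<in> {..<k} \<rightarrow> Hom C X A \<longrightarrow>
      (\<forall>j<dim_col (map_mat f M). belongs C R r X (col (map_mat f M) j)) \<longrightarrow>
      belongs C R r X (vec (dim_row M) (\<lambda>_. f 0)))"
    unfolding closed_over_def interpretations_def by blast
  then show ?thesis unfolding P Q by blast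
qed

lemma closed_overD:
  assumes "closed_over C M A R r X" and "dim_vec r = dim_row M"
    and "k > 0" and "M \<in> matr (dim_row M) (dim_col M) k" and "f \<in> {..<k} \<rightarrow> Hom C X A"
    and "\<And>j. j < dim_col M \<Longrightarrow> \<exists>u\<in>Hom C X R. \<forall>i<dim_row M. Comp C (r $ i) u = f (M $$ (i, j))"
  shows "\<exists>u\<in>Hom C X R. \<forall>i<dim_row M. Comp C (r $ i) u = f 0"
  using assms(1)[unfolded closed_over_iff[OF assms(2)], rule_format, OF assms(3,5,4)] assms(6)
  by blast

lemma matr_entry: "M \<in> matr n m k \<Longrightarrow> i < n \<Longrightarrow> j < m \<Longrightarrow> M $$ (i, j) < k"
  by (simp add: matr_def)

lemma (in cat_iso) has_closed_relations_map:
  assumes closed: "has_closed_relations C M"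
  shows "has_closed_relations D M"
  unfolding has_closed_relations_def
proof (intro allI impI ballI)
  fix A R r X
  assume r: "internal_relation D (dim_row M) A R r" and X: "X \<in> Ob D"
  define r' where "r' = map_vec h' r"
  have dim: "dim_vec r = dim_row M" using r by (simp add: internal_relation_def)
  have AR: "A \<in> Ob D" "R \<in> Ob D" using r by (auto simp: internal_relation_def)
  have rHom: "r $ i \<in> Hom D R A" if "i < dim_row M" for i
    using r that by (auto simp: internal_relation_def)
  have r'i: "r' $ i = h' (r $ i)" if "i < dim_row M" for i
    using that dim by (simp add: r'_def)
  have "internal_relation C (dim_row M) (g' A) (g' R) r'"
    unfolding internal_relation_def
  proof (intro conjI allI impI ballI)
    show "r' \<in> carrier_vec (dim_row M)" by (simp add: r'_def carrier_vecI dim)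
    show "r' $ i \<in> Hom C (g' R) (g' A)" if "i < dim_row M" for i
      using that rHom Hom_map' by (simp add: r'i)
  next
    fix Y u v
    assume Y: "Y \<in> Ob C" and u: "u \<in> Hom C Y (g' R)" and v: "v \<in> Hom C Y (g' R)"
      and eq: "\<forall>i<dim_row M. Comp C (r' $ i) u = Comp C (r' $ i) v"
    have "h u \<in> Hom D (g Y) R" "h v \<in> Hom D (g Y) R"
      using Hom_map[OF u] Hom_map[OF v] Ob_map' AR by auto
    moreover have "Comp D (r $ i) (h u) = Comp D (r $ i) (h v)" if i: "i < dim_row M" for i
    proof -
      have "h' (r $ i) \<in> Hom C (g' R) (g' A)" "h (h' (r $ i)) = r $ i"
        using Hom_map'[OF rHom[OF i]] by auto
      then show ?thesis using Comp_map u v eq i r'i by metis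
    qed
    ultimately have "h u = h v" using r Ob_map[OF Y] unfolding internal_relation_def by blast
    then show "u = v" using Hom_map u v by metis
  qed (use AR Ob_map' in auto)
  then have clo: "closed_over C M (g' A) (g' R) r' (g' X)"
    using closed X Ob_map' by (auto simp: has_closed_relations_def)
  have dim': "dim_vec r' = dim_row M" by (simp add: r'_def dim)
  show "closed_over D M A R r X"
    unfolding closed_over_iff[where r=r and M=M, OF dim]
  proof (intro allI ballI impI)
    fix k :: nat and f
    assume k: "k > 0" and f: "f \<in> {..<k} \<rightarrow> Hom D X A"
      and M: "M \<in> matr (dim_row M) (dim_col M) k"
      and cols: "\<forall>j<dim_col M. \<exists>u\<in>Hom D X R. \<forall>i<dim_row M. Comp D (r $ i) u = f (M $$ (i, j))"
    have "h' \<circ> f \<in> {..<k} \<rightarrow> Hom C (g' X) (g' A)" using f Hom_map' by fastforce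
    moreover have "\<exists>u\<in>Hom C (g' X) (g' R). \<forall>i<dim_row M. Comp C (r' $ i) u = (h' \<circ> f) (M $$ (i, j))"
      if "j < dim_col M" for j
    proof -
      from cols that obtain u where u: "u \<in> Hom D X R"
        "\<forall>i<dim_row M. Comp D (r $ i) u = f (M $$ (i, j))" by auto
      have "\<forall>i<dim_row M. Comp C (r' $ i) (h' u) = h' (f (M $$ (i, j)))"
      proof (intro allI impI)
        fix i assume i: "i < dim_row M"
        show "Comp C (r' $ i) (h' u) = h' (f (M $$ (i, j)))"
          using Comp_map'[OF u(1) rHom[OF i]] r'i[OF i] u(2) i by simp
      qed
      then show ?thesis using Hom_map'[OF u(1)] by auto
    qed
    ultimately have "\<exists>u\<in>Hom C (g' X) (g' R). \<forall>i<dim_row M. Comp C (r' $ i) u = (h' \<circ> f) 0"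
      by (intro closed_overD[OF clo dim' k M])
    then obtain u where u: "u \<in> Hom C (g' X) (g' R)"
        "\<forall>i<dim_row M. Comp C (r' $ i) u = (h' \<circ> f) 0"
      by auto
    have "Comp D (r $ i) (h u) = f 0" if i: "i < dim_row M" for i
    proof -
      have "h (Comp C (h' (r $ i)) u) = Comp D (r $ i) (h u)"
        using Comp_map[OF u(1)] Hom_map'[OF rHom[OF i]] by metis
      moreover have "Comp C (h' (r $ i)) u = h' (f 0)" using u(2) i r'i by auto
      moreover have "h (h' (f 0)) = f 0" using f k Hom_map' by (auto simp: Pi_iff)
      ultimately show ?thesis by simp
    qed
    moreover have "h u \<in> Hom D X R" using Hom_map[OF u(1)] Ob_map' X AR by auto
    ultimately show "\<exists>u\<in>Hom D X R. \<forall>i<dim_row M. Comp D (r $ i) u = f 0" by blast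
  qed
qed

lemma (in cat_iso) mclex_map: "C \<in> mclex S \<Longrightarrow> D \<in> mclex S"
  using finitely_complete_map has_closed_relations_map by (auto simp: mclex_def)

text \<open>Transport of structure along injections. It serves to renumber finite shapes by natural
  numbers and to copy a category to the types over which \<open>mclex\<close> is taken.\<close>

lemma ex_cat_iso:
  fixes C :: "('o, 'm) cat"
  assumes "category C" and "Ob C \<lesssim> (UNIV :: 'p set)" and "Arr C \<lesssim> (UNIV :: 'q set)"
  shows "\<exists>(D :: ('p, 'q) cat) g h g' h'. cat_iso C D g h g' h' \<and> Ob D = g ` Ob C \<and> Arr D = h ` Arr C"
proof -
  interpret category C by fact
  from assms(2) obtain g :: "'o \<Rightarrow> 'p" where g: "inj_on g (Ob C)" by (auto simp: lepoll_def)
  from assms(3) obtain h :: "'m \<Rightarrow> 'q" where h: "inj_on h (Arr C)" by (auto simp: lepoll_def)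
  define g' where "g' = inv_into (Ob C) g"
  define h' where "h' = inv_into (Arr C) h"
  have [simp]: "g' (g X) = X" if "X \<in> Ob C" for X using that g by (simp add: g'_def)
  have [simp]: "h' (h f) = f" if "f \<in> Arr C" for f using that h by (simp add: h'_def)
  define D where "D = \<lparr>Ob = g ` Ob C, Arr = h ` Arr C, Dom = g \<circ> Dom C \<circ> h', Cod = g \<circ> Cod C \<circ> h',
    Ident = h \<circ> Ident C \<circ> g', Comp = (\<lambda>k f. h (Comp C (h' k) (h' f)))\<rparr>"
  have D: "Ob D = g ` Ob C" "Arr D = h ` Arr C" "Dom D k = g (Dom C (h' k))"
    "Cod D k = g (Cod C (h' k))" "Ident D Y = h (Ident C (g' Y))"
    "Comp D k l = h (Comp C (h' k) (h' l))" for k l Y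
    by (simp_all add: D_def)
  have HomD: "k \<in> Hom D V W \<longleftrightarrow> (\<exists>X Y f. f \<in> Hom C X Y \<and> k = h f \<and> V = g X \<and> W = g Y)" for k V W
    by (auto simp: Hom_def D)
  have HomD_D: "\<exists>f. f \<in> Hom C (g' V) (g' W) \<and> k = h f \<and> g' V \<in> Ob C \<and> g' W \<in> Ob C
      \<and> V = g (g' V) \<and> W = g (g' W)"
    if "k \<in> Hom D V W" for k V W
    using that Hom_Ob by (fastforce simp: HomD)
  have h'h: "h' (h f) = f" if "f \<in> Hom C X Y" for f X Y using that by (simp add: Hom_def)
  have hHom: "h f \<in> Hom D (g X) (g Y)" if "f \<in> Hom C X Y" for f X Y using that by (auto simp: HomD)
  have cat: "category D"
  proof
    fix X assume "X \<in> Ob D" then show "Ident D X \<in> Hom D X X"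
      using Ident_Hom by (auto simp: D intro!: hHom)
  next
    fix k l X Y Z assume "k \<in> Hom D X Y" "l \<in> Hom D Y Z"
    then show "Comp D l k \<in> Hom D X Z"
      by (auto simp: D h'h dest!: HomD_D) (metis Comp_Hom hHom)
  next
    fix W X Y Z k l m assume "k \<in> Hom D W X" "l \<in> Hom D X Y" "m \<in> Hom D Y Z"
    then obtain k' l' m' W' X' Y' Z' where "k' \<in> Hom C W' X'" "l' \<in> Hom C X' Y'" "m' \<in> Hom C Y' Z'"
      "k = h k'" "l = h l'" "m = h m'"
      by (auto dest!: HomD_D)
    then show "Comp D m (Comp D l k) = Comp D (Comp D m l) k"
      by (simp add: D h'h[OF Comp_Hom] h'h Comp_assoc)
  next
    fix f X Y assume "f \<in> Hom D X Y"
    then obtain f' where f': "f' \<in> Hom C (g' X) (g' Y)" "f = h f'" "g' X \<in> Ob C" "g' Y \<in> Ob C"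
      by (auto dest!: HomD_D)
    show "Comp D (Ident D Y) f = f" "Comp D f (Ident D X) = f"
      using f' h'h[OF Ident_Hom] by (simp_all add: D h'h Comp_Ident_left Comp_Ident_right)
  qed (use Dom_Ob Cod_Ob in \<open>auto simp: D\<close>)
  interpret D: category D by (rule cat)
  have "cat_iso C D g h g' h'"
  proof
    fix k V W assume "k \<in> Hom D V W"
    then show "h' k \<in> Hom C (g' V) (g' W) \<and> h (h' k) = k" by (auto dest!: HomD_D simp: h'h)
  qed (auto simp: D h'h hHom)
  then show ?thesis using D by blast
qed

section \<open>Limits of finite diagrams indexed by arbitrary types\<close>

lemma finitely_complete_limit:
  fixes J :: "('i, 'j) cat"
  assumes C: "finitely_complete C" and J: "category J" and fin: "finite (Ob J)" "finite (Arr J)"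
    and F: "is_functor J C Fo Fa"
  shows "\<exists>L p. is_limit J C Fo Fa L p"
proof -
  have "Ob J \<lesssim> (UNIV :: nat set)" "Arr J \<lesssim> (UNIV :: nat set)"
    using fin finite_imp_inj_to_nat_seg unfolding lepoll_def by (meson subset_UNIV)+
  then obtain K :: "(nat, nat) cat" and g h g' h' where iso: "cat_iso J K g h g' h'"
    and K: "Ob K = g ` Ob J" "Arr K = h ` Arr J"
    using ex_cat_iso[OF J] by metis
  interpret cat_iso J K g h g' h' by (rule iso)
  have DomK: "g' (Dom K a) = Dom J (h' a)" "g' (Cod K a) = Cod J (h' a)" "h' a \<in> Arr J" if "a \<in> Arr K" for a
    using Hom_map'[of a] that by (auto simp: Hom_def)
  have DomJ: "g (Dom J a) = Dom K (h a)" "g (Cod J a) = Cod K (h a)" "h a \<in> Arr K"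
     "h' (h a) = a" if "a \<in> Arr J" for a
    using Hom_map[of a] that by (auto simp: Hom_def)
  have F': "is_functor K C (Fo \<circ> g') (Fa \<circ> h')"
    unfolding is_functor_def
  proof (intro conjI ballI impI)
    fix a b assume ab: "a \<in> Arr K" "b \<in> Arr K" "Cod K a = Dom K b"
    then have "h' (Comp K b a) = Comp J (h' b) (h' a)"
      by (intro Comp_map'[of a "Dom K a" "Cod K a" b "Cod K b"]) (auto simp: Hom_def)
    then show "(Fa \<circ> h') (Comp K b a) = Comp C ((Fa \<circ> h') b) ((Fa \<circ> h') a)"
      using F ab DomK[OF ab(1)] DomK[OF ab(2)] by (auto simp: is_functor_def)
  qed (use F Ob_map' Ident_map' DomK in \<open>auto simp: is_functor_def\<close>)
  then obtain L p where L: "is_limit K C (Fo \<circ> g') (Fa \<circ> h') L p"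
    using C fin K D.category_axioms unfolding finitely_complete_def by fastforce
  have cone: "is_cone J C Fo Fa L (q \<circ> g)" if "is_cone K C (Fo \<circ> g') (Fa \<circ> h') L q" for L q
    unfolding is_cone_def
  proof (intro conjI ballI)
    fix a assume a: "a \<in> Arr J"
    then show "Comp C (Fa a) ((q \<circ> g) (Dom J a)) = (q \<circ> g) (Cod J a)"
      using that DomJ[OF a] by (auto simp: is_cone_def)
  next
    fix i assume "i \<in> Ob J"
    then show "(q \<circ> g) i \<in> Hom C L (Fo i)" using that Ob_map[of i] by (auto simp: is_cone_def)
  qed (use that in \<open>auto simp: is_cone_def\<close>)
  have cone': "is_cone K C (Fo \<circ> g') (Fa \<circ> h') L (q \<circ> g')" if "is_cone J C Fo Fa L q" for L q
    using that Ob_map' DomK by (auto simp: is_cone_def)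
  have "is_limit J C Fo Fa L (p \<circ> g)"
    unfolding is_limit_def
  proof (intro conjI allI impI)
    show "is_cone J C Fo Fa L (p \<circ> g)" using cone L by (simp add: is_limit_def)
  next
    fix L' q assume "is_cone J C Fo Fa L' q"
    from cone'[OF this] L
    have "\<exists>!u. u \<in> Hom C L' L \<and> (\<forall>i\<in>Ob K. Comp C (p i) u = (q \<circ> g') i)"
      unfolding is_limit_def by blast
    moreover have "(\<forall>i\<in>Ob K. Comp C (p i) u = (q \<circ> g') i) \<longleftrightarrow> (\<forall>i\<in>Ob J. Comp C ((p \<circ> g) i) u = q i)" for u
      using Ob_map by (simp add: K)
    ultimately show "\<exists>!u. u \<in> Hom C L' L \<and> (\<forall>i\<in>Ob J. Comp C ((p \<circ> g) i) u = q i)" by simp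
  qed
  then show ?thesis by blast
qed

text \<open>Finite products and the relation built in \<open>closed_relation_row_closed\<close> are
  limits of this form. By \<open>bip\<close> no object is both a source and a target, so no two of
  the given arrows compose, and adjoining identities already yields a category.\<close>

lemma bipartite_limit:
  fixes D :: "'i \<Rightarrow> 'o" and s t :: "'k \<Rightarrow> 'i"
  assumes C: "finitely_complete C" and fin: "finite I" "finite K"
    and D: "\<And>i. i \<in> I \<Longrightarrow> D i \<in> Ob C"
    and st: "\<And>l. l \<in> K \<Longrightarrow> s l \<in> I \<and> t l \<in> I \<and> a l \<in> Hom C (D (s l)) (D (t l))"
    and bip: "\<And>l l'. l \<in> K \<Longrightarrow> l' \<in> K \<Longrightarrow> s l \<noteq> t l'"
  obtains L p where "L \<in> Ob C" and "\<And>i. i \<in> I \<Longrightarrow> p i \<in> Hom C L (D i)"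
    and "\<And>l. l \<in> K \<Longrightarrow> Comp C (a l) (p (s l)) = p (t l)"
    and "\<And>X q. X \<in> Ob C \<Longrightarrow> (\<And>i. i \<in> I \<Longrightarrow> q i \<in> Hom C X (D i)) \<Longrightarrow>
      (\<And>l. l \<in> K \<Longrightarrow> Comp C (a l) (q (s l)) = q (t l)) \<Longrightarrow>
      \<exists>!u. u \<in> Hom C X L \<and> (\<forall>i\<in>I. Comp C (p i) u = q i)"
proof -
  interpret category C using C by (simp add: finitely_complete_def)
  \<comment> \<open>If \<open>g\<close> is an identity, the composite is \<open>f\<close>. Otherwise
    \<open>g\<close> comes from \<open>K\<close>, and \<open>bip\<close> forces a composable
    \<open>f\<close> to be an identity.\<close>
  define J :: "('i, 'i + 'k) cat" where "J = \<lparr>Ob = I, Arr = Inl ` I \<union> Inr ` K,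
    Dom = case_sum id s, Cod = case_sum id t, Ident = Inl,
    Comp = (\<lambda>g f. case g of Inl _ \<Rightarrow> f | Inr _ \<Rightarrow> g)\<rparr>"
  define Fa where "Fa = case_sum (\<lambda>i. Ident C (D i)) a"
  have J: "Ob J = I" "Arr J = Inl ` I \<union> Inr ` K" "Dom J = case_sum id s" "Cod J = case_sum id t"
    "Ident J = Inl" "Comp J g f = (case g of Inl _ \<Rightarrow> f | Inr _ \<Rightarrow> g)" for g f
    by (simp_all add: J_def)
  have HomJE: thesis if "f \<in> Hom J x y" "\<And>i. i \<in> I \<Longrightarrow> f = Inl i \<Longrightarrow> x = i \<Longrightarrow> y = i \<Longrightarrow> thesis"
    "\<And>l. l \<in> K \<Longrightarrow> f = Inr l \<Longrightarrow> x = s l \<Longrightarrow> y = t l \<Longrightarrow> thesis" for f x y thesis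
    using that by (auto simp: Hom_def J)
  have cat: "category J"
  proof
    fix f g X Y Z assume "f \<in> Hom J X Y" "g \<in> Hom J Y Z"
    then show "Comp J g f \<in> Hom J X Z"
      by (elim HomJE) (use bip in \<open>auto simp: J Hom_def\<close>)
  next
    fix f g h W X Y Z assume "f \<in> Hom J W X" "g \<in> Hom J X Y" "h \<in> Hom J Y Z"
    then show "Comp J h (Comp J g f) = Comp J (Comp J h g) f"
      by (elim HomJE) (auto simp: J)
  next
    fix f X Y assume "f \<in> Hom J X Y"
    then show "Comp J (Ident J Y) f = f" "Comp J f (Ident J X) = f"
      by (elim HomJE; simp add: J)+
  qed (use st in \<open>auto simp: J Hom_def\<close>)
  have F: "is_functor J C D Fa"
    unfolding is_functor_def
  proof (intro conjI ballI impI)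
    fix x y assume "x \<in> Arr J" "y \<in> Arr J" "Cod J x = Dom J y"
    then have "x \<in> Hom J (Dom J x) (Cod J x)" "y \<in> Hom J (Cod J x) (Cod J y)"
      by (auto simp: Hom_def)
    then show "Fa (Comp J y x) = Comp C (Fa y) (Fa x)"
    proof (elim HomJE)
      fix i i' assume "i \<in> I" "x = Inl i" "y = Inl i'" "Cod J x = i" "Cod J x = i'"
      then show ?thesis using Comp_Ident_left[OF Ident_Hom[OF D]] by (simp add: J Fa_def)
    next
      fix i l assume "x = Inl i" "y = Inr l" "l \<in> K" "Cod J x = i" "Cod J x = s l"
      then show ?thesis using Comp_Ident_right st[of l] by (auto simp: J Fa_def)
    next
      fix i l assume "x = Inr l" "y = Inl i" "l \<in> K" "Cod J x = t l" "Cod J x = i"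
      then show ?thesis using Comp_Ident_left st[of l] by (auto simp: J Fa_def)
    next
      fix l l' assume "l \<in> K" "l' \<in> K" "Cod J x = t l" "Cod J x = s l'"
      then show ?thesis using bip by metis
    qed
  next
    fix x assume "x \<in> Arr J"
    then show "Fa x \<in> Hom C (D (Dom J x)) (D (Cod J x))"
      using D st Ident_Hom by (auto simp: J(2-4) Fa_def)
  qed (simp_all add: J(1,5) Fa_def D)
  have cone: "is_cone J C D Fa L p \<longleftrightarrow> L \<in> Ob C \<and> (\<forall>i\<in>I. p i \<in> Hom C L (D i)) \<and>
      (\<forall>l\<in>K. Comp C (a l) (p (s l)) = p (t l))" for L p
  proof -
    have "(\<forall>x\<in>Arr J. Comp C (Fa x) (p (Dom J x)) = p (Cod J x)) \<longleftrightarrow>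
        (\<forall>l\<in>K. Comp C (a l) (p (s l)) = p (t l))" if "\<forall>i\<in>I. p i \<in> Hom C L (D i)"
      using that Comp_Ident_left by (auto simp: J(2-4) Fa_def ball_Un)
    then show ?thesis unfolding is_cone_def J(1) by blast
  qed
  have "finite (Ob J)" "finite (Arr J)" using fin by (auto simp: J)
  from finitely_complete_limit[OF C cat this F] obtain L p where L: "is_limit J C D Fa L p"
    by blast
  show thesis
    by (rule that[of L p]) (use L in \<open>auto simp: is_limit_def cone J(1)\<close>)
qed

section \<open>Closedness under rows of a matrix\<close>

text \<open>Ordinary closedness is the case \<open>n = dim_row M\<close>, with \<open>a\<close> the
  identity and \<open>x l\<close> the same for all \<open>l\<close>. Taking the relation as a
  predicate on functions makes equality, with \<open>n = 2\<close>, and the relation of an object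
  instances of one notion.\<close>

definition row_closed :: "nat mat \<Rightarrow> nat \<Rightarrow> 'a set \<Rightarrow> ((nat \<Rightarrow> 'a) \<Rightarrow> bool) \<Rightarrow> bool" where
  "row_closed M n X T \<longleftrightarrow> (\<forall>k>0. M \<in> matr (dim_row M) (dim_col M) k \<longrightarrow>
    (\<forall>a\<in>{..<n} \<rightarrow> {..<dim_row M}. \<forall>x\<in>{..<n} \<rightarrow> {..<k} \<rightarrow> X.
      (\<forall>j<dim_col M. T (\<lambda>l. x l (M $$ (a l, j)))) \<longrightarrow> T (\<lambda>l. x l 0)))"

lemma row_closedI:
  assumes "\<And>k a x. k > 0 \<Longrightarrow> M \<in> matr (dim_row M) (dim_col M) k \<Longrightarrow> a \<in> {..<n} \<rightarrow> {..<dim_row M} \<Longrightarrow>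
    x \<in> {..<n} \<rightarrow> {..<k} \<rightarrow> X \<Longrightarrow> (\<And>j. j < dim_col M \<Longrightarrow> T (\<lambda>l. x l (M $$ (a l, j)))) \<Longrightarrow>
    T (\<lambda>l. x l 0)"
  shows "row_closed M n X T"
  unfolding row_closed_def using assms by simp

lemma row_closedD:
  assumes "row_closed M n X T" and "k > 0" and "M \<in> matr (dim_row M) (dim_col M) k"
    and "a \<in> {..<n} \<rightarrow> {..<dim_row M}" and "x \<in> {..<n} \<rightarrow> {..<k} \<rightarrow> X"
    and "\<And>j. j < dim_col M \<Longrightarrow> T (\<lambda>l. x l (M $$ (a l, j)))"
  shows "T (\<lambda>l. x l 0)"
  using assms(1)[unfolded row_closed_def, rule_format, OF assms(2-5)] assms(6) by simp

text \<open>A Horn clause can be checked componentwise along a family of maps that preserves and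
  jointly reflects the relation. A singleton \<open>H\<close> gives substructures; a general
  \<open>H\<close> gives substructures of products.\<close>

lemma row_closed_INT_vimage:
  assumes closed: "\<And>h. h \<in> H \<Longrightarrow> row_closed M n (Y h) (T h)"
    and f: "\<And>h. h \<in> H \<Longrightarrow> f h \<in> X \<rightarrow> Y h"
    and T': "\<And>t. t \<in> {..<n} \<rightarrow> X \<Longrightarrow> T' t \<longleftrightarrow> (\<forall>h\<in>H. T h (f h \<circ> t))"
  shows "row_closed M n X T'"
proof (rule row_closedI)
  fix k a x
  assume k: "k > 0" and M: "M \<in> matr (dim_row M) (dim_col M) k" and a: "a \<in> {..<n} \<rightarrow> {..<dim_row M}"
    and x: "x \<in> {..<n} \<rightarrow> {..<k} \<rightarrow> X"
    and cols: "\<And>j. j < dim_col M \<Longrightarrow> T' (\<lambda>l. x l (M $$ (a l, j)))"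
  have xX: "(\<lambda>l. x l (c l)) \<in> {..<n} \<rightarrow> X" if "\<And>l. l < n \<Longrightarrow> c l < k" for c
    using x that by (auto simp: Pi_iff)
  have "T h (\<lambda>l. (f h \<circ> x l) 0)" if h: "h \<in> H" for h
  proof (rule row_closedD[OF closed[OF h] k M a])
    show "(\<lambda>l. f h \<circ> x l) \<in> {..<n} \<rightarrow> {..<k} \<rightarrow> Y h"
      using x f[OF h] by (auto simp: Pi_iff)
    fix j assume j: "j < dim_col M"
    have "(\<lambda>l. x l (M $$ (a l, j))) \<in> {..<n} \<rightarrow> X"
      by (rule xX) (use a matr_entry[OF M _ j] in auto)
    then show "T h (\<lambda>l. (f h \<circ> x l) (M $$ (a l, j)))"
      using T' cols[OF j] h by (auto simp: comp_def)
  qed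
  then show "T' (\<lambda>l. x l 0)"
    using T'[OF xX[of "\<lambda>_. 0"]] k by (simp add: comp_def)
qed

text \<open>Closedness is applied to a relation of arity \<open>dim_row M\<close> on the
  \<open>n\<close>-th power of \<open>A\<close>: tuples \<open>y i\<close>, one for each row
  \<open>i\<close>, are related when taking the coordinate \<open>l\<close> of
  \<open>y (a l)\<close> for every \<open>l\<close> gives a tuple of \<open>R\<close>. The separate
  families \<open>x l\<close> then become a single interpretation in the power.\<close>

lemma closed_relation_row_closed:
  assumes C: "finitely_complete C" and closed: "has_closed_relations C M"
    and r: "internal_relation C n A R r" and Y: "Y \<in> Ob C"
  shows "row_closed M n (Hom C Y A) (\<lambda>t. \<exists>u\<in>Hom C Y R. \<forall>l<n. Comp C (r $ l) u = t l)"
proof (rule row_closedI)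
  interpret category C using C by (simp add: finitely_complete_def)
  let ?p = "dim_row M"
  have A: "A \<in> Ob C" and R: "R \<in> Ob C" and rHom: "\<And>l. l < n \<Longrightarrow> r $ l \<in> Hom C R A"
    using r by (auto simp: internal_relation_def)
  have monic: "u = v" if "u \<in> Hom C X R" "v \<in> Hom C X R"
    "\<And>l. l < n \<Longrightarrow> Comp C (r $ l) u = Comp C (r $ l) v" for u v X
    using r Hom_Ob(1)[OF that(1)] that unfolding internal_relation_def by blast
  fix k a x
  assume k: "k > 0" and M: "M \<in> matr (dim_row M) (dim_col M) k" and a: "a \<in> {..<n} \<rightarrow> {..<dim_row M}"
    and x: "x \<in> {..<n} \<rightarrow> {..<k} \<rightarrow> Hom C Y A"
    and cols: "\<And>j. j < dim_col M \<Longrightarrow>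
      \<exists>u\<in>Hom C Y R. \<forall>l<n. Comp C (r $ l) u = x l (M $$ (a l, j))"
  have al: "a l < ?p" if "l < n" for l using a that by auto
  have xHom: "x l c \<in> Hom C Y A" if "l < n" "c < k" for l c
    using x that by (auto simp: Pi_iff)
  \<comment> \<open>With no arrows the bipartite limit is the product of \<open>n\<close> copies of
    \<open>A\<close>.\<close>
  obtain P \<pi> where P: "P \<in> Ob C" and \<pi>: "\<And>l. l \<in> {..<n} \<Longrightarrow> \<pi> l \<in> Hom C P A"
    and P_univ: "\<And>X q. X \<in> Ob C \<Longrightarrow> (\<And>l. l \<in> {..<n} \<Longrightarrow> q l \<in> Hom C X A) \<Longrightarrow>
      \<exists>!u. u \<in> Hom C X P \<and> (\<forall>l\<in>{..<n}. Comp C (\<pi> l) u = q l)"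
    by (rule bipartite_limit[OF C, of "{..<n}" "{} :: nat set" "\<lambda>_. A"]) (use A in auto)
  \<comment> \<open>\<open>Some (i, l)\<close> stands for the coordinate \<open>l\<close> of the
    \<open>i\<close>-th tuple and \<open>None\<close> for an element of \<open>R\<close>; the arrows
    force the entry \<open>(a l, l)\<close> to be the coordinate \<open>l\<close> of that
    element.\<close>
  let ?I = "insert None (Some ` ({..<?p} \<times> {..<n}))"
  let ?D = "case_option R (\<lambda>_. A)"
  obtain T \<tau> where T: "T \<in> Ob C" and \<tau>: "\<And>i. i \<in> ?I \<Longrightarrow> \<tau> i \<in> Hom C T (?D i)"
    and T_eq: "\<And>l. l \<in> {..<n} \<Longrightarrow> Comp C (r $ l) (\<tau> None) = \<tau> (Some (a l, l))"
    and T_univ: "\<And>X q. X \<in> Ob C \<Longrightarrow> (\<And>i. i \<in> ?I \<Longrightarrow> q i \<in> Hom C X (?D i)) \<Longrightarrow>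
      (\<And>l. l \<in> {..<n} \<Longrightarrow> Comp C (r $ l) (q None) = q (Some (a l, l))) \<Longrightarrow>
      \<exists>!u. u \<in> Hom C X T \<and> (\<forall>i\<in>?I. Comp C (\<tau> i) u = q i)"
    by (rule bipartite_limit[OF C, of ?I "{..<n}" ?D "\<lambda>_. None" "\<lambda>l. Some (a l, l)" "\<lambda>l. r $ l"])
      (use A R rHom al in auto)
  have \<tau>None: "\<tau> None \<in> Hom C T R" and \<tau>Some: "\<And>i l. i < ?p \<Longrightarrow> l < n \<Longrightarrow> \<tau> (Some (i, l)) \<in> Hom C T A"
    using \<tau>[of None] \<tau>[of "Some _"] by auto
  have "\<forall>i<?p. \<exists>u. u \<in> Hom C T P \<and> (\<forall>l\<in>{..<n}. Comp C (\<pi> l) u = \<tau> (Some (i, l)))"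
    using P_univ[OF T, of "\<lambda>l. \<tau> (Some (_, l))"] \<tau>Some by (meson lessThan_iff)
  then obtain \<sigma> where \<sigma>: "\<And>i. i < ?p \<Longrightarrow> \<sigma> i \<in> Hom C T P"
    and \<pi>\<sigma>: "\<And>i l. i < ?p \<Longrightarrow> l < n \<Longrightarrow> Comp C (\<pi> l) (\<sigma> i) = \<tau> (Some (i, l))"
    by (metis lessThan_iff)
  have \<tau>\<sigma>: "Comp C (\<tau> (Some (i, l))) u = Comp C (\<pi> l) (Comp C (\<sigma> i) u)"
    if "i < ?p" "l < n" "u \<in> Hom C X T" for i l u X
    using \<pi>\<sigma>[OF that(1,2)] Comp_assoc[OF that(3) \<sigma>[OF that(1)] \<pi>] that(2) by simp
  have r\<tau>: "Comp C (r $ l) (Comp C (\<tau> None) u) = Comp C (\<tau> (Some (a l, l))) u"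
    if "l < n" "u \<in> Hom C X T" for l u X
    using T_eq[of l] Comp_assoc[OF that(2) \<tau>None rHom[OF that(1)]] that(1) by simp
  let ?s = "vec ?p \<sigma>"
  have rel: "internal_relation C ?p P T ?s"
    unfolding internal_relation_def
  proof (intro conjI allI impI ballI)
    fix X u v assume X: "X \<in> Ob C" and u: "u \<in> Hom C X T" and v: "v \<in> Hom C X T"
      and eq: "\<forall>i<?p. Comp C (?s $ i) u = Comp C (?s $ i) v"
    have Some_eq: "Comp C (\<tau> (Some (i, l))) u = Comp C (\<tau> (Some (i, l))) v" if "i < ?p" "l < n" for i l
      using that eq \<tau>\<sigma> u v by auto
    \<comment> \<open>The \<open>None\<close> component is not among the legs; it is recovered from
      the entries \<open>(a l, l)\<close> because the legs of \<open>R\<close> are jointly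
      monic.\<close>
    have "Comp C (\<tau> None) u = Comp C (\<tau> None) v"
      by (rule monic[OF Comp_Hom[OF u \<tau>None] Comp_Hom[OF v \<tau>None]])
        (use r\<tau> u v Some_eq al in auto)
    then have eqI: "\<forall>i\<in>?I. Comp C (\<tau> i) v = Comp C (\<tau> i) u" using Some_eq by auto
    have "\<exists>!w. w \<in> Hom C X T \<and> (\<forall>i\<in>?I. Comp C (\<tau> i) w = Comp C (\<tau> i) u)"
      using u by (intro T_univ[OF X]) (auto intro: Comp_Hom[OF _ \<tau>None] Comp_Hom[OF _ \<tau>Some] simp: r\<tau>)
    with u v eqI show "u = v" by blast
  qed (use P T \<sigma> in auto)
  \<comment> \<open>The interpretation of \<open>M\<close> in the power: \<open>f c\<close> is the
    morphism with coordinates \<open>x l c\<close>.\<close>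
  have "\<forall>c\<in>{..<k}. \<exists>f. f \<in> Hom C Y P \<and> (\<forall>l\<in>{..<n}. Comp C (\<pi> l) f = x l c)"
    using P_univ[OF Y, of "\<lambda>l. x l _"] xHom by (meson lessThan_iff)
  then obtain f where f: "\<And>c. c < k \<Longrightarrow> f c \<in> Hom C Y P"
    and \<pi>f: "\<And>c l. c < k \<Longrightarrow> l < n \<Longrightarrow> Comp C (\<pi> l) (f c) = x l c"
    by (metis lessThan_iff)
  have "\<exists>u\<in>Hom C Y T. \<forall>i<?p. Comp C (?s $ i) u = f 0"
  proof (rule closed_overD[OF _ _ k M])
    show "closed_over C M P T ?s Y"
      using closed rel Y by (auto simp: has_closed_relations_def)
    show "f \<in> {..<k} \<rightarrow> Hom C Y P" using f by auto
    fix j assume j: "j < dim_col M"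
    have Mk: "M $$ (i, j) < k" if "i < ?p" for i using matr_entry[OF M that j] .
    obtain w where w: "w \<in> Hom C Y R" "\<forall>l<n. Comp C (r $ l) w = x l (M $$ (a l, j))"
      using cols[OF j] by blast
    \<comment> \<open>The lift of the \<open>j\<close>-th left column combines \<open>w\<close> with
      the array whose entry \<open>(i, l)\<close> is \<open>x l (M $$ (i, j))\<close>.\<close>
    have "\<exists>!u. u \<in> Hom C Y T \<and> (\<forall>i\<in>?I. Comp C (\<tau> i) u =
        case_option w (\<lambda>(i, l). x l (M $$ (i, j))) i)"
    proof (rule T_univ[OF Y])
      fix i assume "i \<in> ?I"
      then consider "i = None" | i' l where "i = Some (i', l)" "i' < ?p" "l < n" by auto
      then show "case_option w (\<lambda>(i, l). x l (M $$ (i, j))) i \<in> Hom C Y (?D i)"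
        by cases (simp_all add: w(1) xHom Mk)
    qed (simp add: w(2))
    from ex1_implies_ex[OF this] obtain u where u: "u \<in> Hom C Y T"
      "\<And>i l. i < ?p \<Longrightarrow> l < n \<Longrightarrow> Comp C (\<tau> (Some (i, l))) u = x l (M $$ (i, j))"
      by auto
    have "Comp C (\<sigma> i) u = f (M $$ (i, j))" if i: "i < ?p" for i
    proof -
      have "\<exists>!v. v \<in> Hom C Y P \<and> (\<forall>l\<in>{..<n}. Comp C (\<pi> l) v = x l (M $$ (i, j)))"
        using xHom Mk[OF i] by (intro P_univ[OF Y]) auto
      moreover have "Comp C (\<pi> l) (Comp C (\<sigma> i) u) = x l (M $$ (i, j))" if "l < n" for l
        using \<tau>\<sigma>[OF i that u(1)] u(2)[OF i that] by simp
      ultimately show ?thesis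
        using Comp_Hom[OF u(1) \<sigma>[OF i]] f[OF Mk[OF i]] \<pi>f[OF Mk[OF i]] by blast
    qed
    with u(1) show "\<exists>u\<in>Hom C Y T. \<forall>i<?p. Comp C (?s $ i) u = f (M $$ (i, j))" by auto
  qed simp
  then obtain u where u: "u \<in> Hom C Y T" "\<And>i. i < ?p \<Longrightarrow> Comp C (\<sigma> i) u = f 0" by auto
  have "Comp C (r $ l) (Comp C (\<tau> None) u) = x l 0" if l: "l < n" for l
    using r\<tau>[OF l u(1)] \<tau>\<sigma>[OF al[OF l] l u(1)] u(2)[OF al[OF l]] \<pi>f[OF k l] by simp
  then show "\<exists>u\<in>Hom C Y R. \<forall>l<n. Comp C (r $ l) u = x l 0"
    using Comp_Hom[OF u(1) \<tau>None] by blast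
qed

text \<open>Equality of morphisms into \<open>A\<close> is membership in the diagonal, the binary
  internal relation both of whose legs are the identity of \<open>A\<close>.\<close>

lemma row_closed_Hom_eq:
  assumes C: "finitely_complete C" and closed: "has_closed_relations C M"
    and A: "A \<in> Ob C" and Y: "Y \<in> Ob C"
  shows "row_closed M 2 (Hom C Y A) (\<lambda>t. t 0 = t 1)"
proof -
  interpret category C using C by (simp add: finitely_complete_def)
  have "internal_relation C 2 A A (vec 2 (\<lambda>_. Ident C A))"
    unfolding internal_relation_def
  proof (intro conjI allI impI ballI)
    fix X u v assume u: "u \<in> Hom C X A" "v \<in> Hom C X A"
      and "\<forall>i<2. Comp C (vec 2 (\<lambda>_. Ident C A) $ i) u = Comp C (vec 2 (\<lambda>_. Ident C A) $ i) v"
    from this(3)[rule_format, of 0] show "u = v" using Comp_Ident_left u by simp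
  qed (use A Ident_Hom in auto)
  note rel = this
  have all2: "(\<forall>l<2. P l) \<longleftrightarrow> P 0 \<and> P 1" for P :: "nat \<Rightarrow> bool"
    by (auto simp: less_2_cases_iff)
  from closed_relation_row_closed[OF C closed rel Y]
  show ?thesis
  proof (rule row_closed_INT_vimage[where H="{()}" and f="\<lambda>_ x. x"])
    fix t :: "nat \<Rightarrow> 'b" assume "t \<in> {..<2} \<rightarrow> Hom C Y A"
    then have "t 0 \<in> Hom C Y A" "t 1 \<in> Hom C Y A" by auto
    then show "t 0 = t 1 \<longleftrightarrow> (\<forall>h\<in>{()}. \<exists>u\<in>Hom C Y A. \<forall>l<2.
        Comp C (vec 2 (\<lambda>_. Ident C A) $ l) u = ((\<lambda>x. x) \<circ> t) l)"
      using Comp_Ident_left by (auto simp: all2)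
  qed auto
qed

section \<open>The category of sets with an n-ary relation\<close>

definition relmap :: "'a set \<times> 'a vec set \<Rightarrow> ('a \<Rightarrow> 'b) \<Rightarrow> 'b set \<times> 'b vec set \<Rightarrow> bool" where
  "relmap P f Q \<longleftrightarrow> f \<in> fst P \<rightarrow>\<^sub>E fst Q \<and> map_vec f ` snd P \<subseteq> snd Q"

lemma tuples_iff: "t \<in> tuples n X \<longleftrightarrow> dim_vec t = n \<and> (\<forall>i<n. t $ i \<in> X)"
  unfolding tuples_def mem_Collect_eq carrier_dim_vec ..

lemma map_vec_tuples: "t \<in> tuples n X \<Longrightarrow> f \<in> X \<rightarrow> Y \<Longrightarrow> map_vec f t \<in> tuples n Y"
  by (auto simp: tuples_iff)

lemma map_vec_compose:
  "t \<in> tuples n X \<Longrightarrow> map_vec (compose X g f) t = map_vec g (map_vec f t)"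
  by (auto simp: tuples_iff compose_def)

lemma Ob_Rel: "P \<in> Ob (Rel U n) \<longleftrightarrow> fst P \<in> U \<and> snd P \<subseteq> tuples n (fst P)"
  by (auto simp: Rel_def)

lemma Hom_Rel: "f \<in> Hom (Rel U n) P Q \<longleftrightarrow>
    P \<in> Ob (Rel U n) \<and> Q \<in> Ob (Rel U n) \<and> (\<exists>\<phi>. f = (P, \<phi>, Q) \<and> relmap P \<phi> Q)"
  by (cases P; cases Q) (auto simp: Rel_def Hom_def relmap_def)

lemma Comp_Rel: "Comp (Rel U n) (Q', \<psi>, R) (P, \<phi>, Q) = (P, compose (fst P) \<psi> \<phi>, R)"
  by (simp add: Rel_def)

lemma Ident_Rel: "Ident (Rel U n) P = (P, restrict id (fst P), P)"
  by (cases P) (simp add: Rel_def)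

lemma relmap_compose:
  assumes "relmap P f Q" "relmap Q g R" "snd P \<subseteq> tuples n (fst P)"
  shows "relmap P (compose (fst P) g f) R"
  unfolding relmap_def
proof (intro conjI subsetI)
  show "compose (fst P) g f \<in> fst P \<rightarrow>\<^sub>E fst R"
    using assms(1,2) unfolding relmap_def compose_def by auto
  fix t assume "t \<in> map_vec (compose (fst P) g f) ` snd P"
  then show "t \<in> snd R"
    using assms map_vec_compose[of _ n "fst P" g f] unfolding relmap_def by fastforce
qed

lemma category_Rel: "category (Rel U n)"
proof
  fix f assume "f \<in> Arr (Rel U n)"
  then have "f \<in> Hom (Rel U n) (Dom (Rel U n) f) (Cod (Rel U n) f)" by (simp add: Hom_def)
  then show "Dom (Rel U n) f \<in> Ob (Rel U n)" "Cod (Rel U n) f \<in> Ob (Rel U n)"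
    by (simp_all add: Hom_Rel)
next
  fix X assume X: "X \<in> Ob (Rel U n)"
  have "map_vec (restrict id (fst X)) t = t" if "t \<in> snd X" for t
    using X that by (intro eq_vecI) (auto simp: Ob_Rel tuples_iff)
  then show "Ident (Rel U n) X \<in> Hom (Rel U n) X X"
    using X by (auto simp: Hom_Rel Ident_Rel relmap_def)
next
  fix f g X Y Z assume "f \<in> Hom (Rel U n) X Y" "g \<in> Hom (Rel U n) Y Z"
  then show "Comp (Rel U n) g f \<in> Hom (Rel U n) X Z"
    using relmap_compose[of X _ Y _ Z n] by (auto simp: Hom_Rel Comp_Rel Ob_Rel)
next
  fix f X Y assume "f \<in> Hom (Rel U n) X Y"
  then obtain \<phi> where f: "f = (X, \<phi>, Y)" "\<phi> \<in> fst X \<rightarrow>\<^sub>E fst Y" by (auto simp: Hom_Rel relmap_def)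
  then have "compose (fst X) (restrict id (fst Y)) \<phi> = \<phi>" "compose (fst X) \<phi> (restrict id (fst X)) = \<phi>"
    by (auto simp: compose_def fun_eq_iff PiE_def extensional_def)
  then show "Comp (Rel U n) (Ident (Rel U n) Y) f = f" "Comp (Rel U n) f (Ident (Rel U n) X) = f"
    by (simp_all add: f Ident_Rel Comp_Rel)
next
  fix f g h W X Y Z
  assume "f \<in> Hom (Rel U n) W X" "g \<in> Hom (Rel U n) X Y" "h \<in> Hom (Rel U n) Y Z"
  then show "Comp (Rel U n) h (Comp (Rel U n) g f) = Comp (Rel U n) (Comp (Rel U n) h g) f"
    by (auto simp: Hom_Rel Comp_Rel relmap_def compose_def fun_eq_iff)
qed

section \<open>Test objects in the universe, jointly epic families and extension problems\<close>

lemma set_universe_subset: "set_universe U \<Longrightarrow> X \<in> U \<Longrightarrow> Y \<subseteq> X \<Longrightarrow> Y \<in> U"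
  by (auto simp: set_universe_def)

text \<open>Test objects are described by natural numbers and copied into \<open>'u\<close> by
  \<open>g\<close>; all the images lie in the universe as subsets of one infinite member.\<close>

lemma set_universe_nat:
  fixes U :: "'u set set"
  assumes "set_universe U"
  obtains g :: "nat \<Rightarrow> 'u" where "inj g" and "\<And>A. g ` A \<in> U"
proof -
  obtain X where X: "X \<in> U" "infinite X" using assms by (auto simp: set_universe_def)
  then obtain g :: "nat \<Rightarrow> 'u" where g: "inj g" "range g \<subseteq> X"
    by (meson infinite_iff_countable_subset)
  show thesis
    by (rule that[OF g(1) set_universe_subset[OF assms X(1)]]) (use g(2) in auto)
qed

text \<open>Functions that agree after composition with a jointly surjective family are equal, so
  the family is jointly epic, and jointly monic in the dual.\<close>

lemma Rel_internal_relationI: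
  assumes "B \<in> Ob (Rel U n) \<inter> A" "Q \<in> Ob (Rel U n) \<inter> A"
    and \<rho>: "\<And>i. i < p \<Longrightarrow> relmap B (\<rho> i) Q" and surj: "fst Q \<subseteq> (\<Union>i<p. \<rho> i ` fst B)"
  shows "internal_relation (dual (full_subcategory (Rel U n) A)) p B Q (vec p (\<lambda>i. (B, \<rho> i, Q)))"
  unfolding internal_relation_def
proof (intro conjI allI impI ballI)
  fix Y u v
  assume "u \<in> Hom (dual (full_subcategory (Rel U n) A)) Y Q"
    "v \<in> Hom (dual (full_subcategory (Rel U n) A)) Y Q"
    and eq: "\<forall>i<p. Comp (dual (full_subcategory (Rel U n) A)) (vec p (\<lambda>i. (B, \<rho> i, Q)) $ i) u =
      Comp (dual (full_subcategory (Rel U n) A)) (vec p (\<lambda>i. (B, \<rho> i, Q)) $ i) v"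
  then have "u \<in> Hom (Rel U n) Q Y" "v \<in> Hom (Rel U n) Q Y"
    by (auto dest: Hom_full_subcategory_subset)
  then obtain \<phi> \<psi> where uv: "u = (Q, \<phi>, Y)" "v = (Q, \<psi>, Y)" "\<phi> \<in> extensional (fst Q)" "\<psi> \<in> extensional (fst Q)"
    by (auto simp: Hom_Rel relmap_def PiE_def)
  have "\<phi> q = \<psi> q" if q: "q \<in> fst Q" for q
  proof -
    obtain i b where ib: "i < p" "b \<in> fst B" "q = \<rho> i b" using surj q by blast
    have "compose (fst B) \<phi> (\<rho> i) = compose (fst B) \<psi> (\<rho> i)"
      using eq ib(1) by (auto simp: uv Comp_Rel)
    then show ?thesis using ib(2,3) by (metis compose_eq)
  qed
  then show "u = v" using uv by (auto intro: extensionalityI)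
qed (use assms in \<open>auto simp: Hom_Rel\<close>)

lemma Rel_internal_relationD:
  assumes "internal_relation (dual (full_subcategory (Rel U n) A)) p B Q r"
  obtains \<rho> where "r = vec p (\<lambda>i. (B, \<rho> i, Q))" and "\<And>i. i < p \<Longrightarrow> relmap B (\<rho> i) Q"
    and "B \<in> Ob (Rel U n) \<inter> A" and "Q \<in> Ob (Rel U n) \<inter> A"
proof -
  have r: "dim_vec r = p" and BQ: "B \<in> Ob (Rel U n) \<inter> A" "Q \<in> Ob (Rel U n) \<inter> A"
    and "\<And>i. i < p \<Longrightarrow> r $ i \<in> Hom (Rel U n) B Q"
    using assms by (auto simp: internal_relation_def)
  then have "\<forall>i<p. \<exists>\<phi>. r $ i = (B, \<phi>, Q) \<and> relmap B \<phi> Q" by (auto simp: Hom_Rel)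
  then obtain \<rho> where "\<forall>i<p. r $ i = (B, \<rho> i, Q) \<and> relmap B (\<rho> i) Q" by metis
  with r BQ show thesis by (intro that[of \<rho>]) auto
qed

text \<open>If all \<open>\<rho> i\<close> missed \<open>q\<close>, two functions differing only at
  \<open>q\<close> would have the same composites with them. Every function into an object with all
  tuples is a morphism, so two such functions contradict joint monicity in the dual once the object
  lies in \<open>A\<close>.\<close>

lemma Rel_internal_relation_surj:
  assumes rel: "internal_relation (dual (full_subcategory (Rel U n) A)) p B Q (vec p (\<lambda>i. (B, \<rho> i, Q)))"
    and \<rho>: "\<And>i. i < p \<Longrightarrow> relmap B (\<rho> i) Q"
    and two: "(X, tuples n X) \<in> Ob (Rel U n) \<inter> A" "x \<in> X" "y \<in> X" "x \<noteq> y"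
  shows "fst Q = (\<Union>i<p. \<rho> i ` fst B)"
proof (rule ccontr)
  assume "fst Q \<noteq> (\<Union>i<p. \<rho> i ` fst B)"
  moreover have "(\<Union>i<p. \<rho> i ` fst B) \<subseteq> fst Q" using \<rho> by (fastforce simp: relmap_def)
  ultimately obtain q where q: "q \<in> fst Q" "q \<notin> (\<Union>i<p. \<rho> i ` fst B)" by blast
  let ?C = "dual (full_subcategory (Rel U n) A)" and ?X = "(X, tuples n X)"
  let ?\<phi> = "restrict (\<lambda>_. x) (fst Q)" and ?\<psi> = "restrict (\<lambda>z. if z = q then y else x) (fst Q)"
  have Q: "Q \<in> Ob (Rel U n) \<inter> A" and B: "B \<in> Ob (Rel U n) \<inter> A"
    using rel by (auto simp: internal_relation_def)
  have Hom: "(Q, \<phi>, ?X) \<in> Hom ?C ?X Q" if "\<phi> \<in> fst Q \<rightarrow>\<^sub>E X" for \<phi>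
  proof -
    have "map_vec \<phi> ` snd Q \<subseteq> tuples n X"
      using Q that by (auto simp: Ob_Rel intro: map_vec_tuples)
    then show ?thesis using that Q two(1) by (simp add: Hom_Rel relmap_def)
  qed
  have "compose (fst B) ?\<phi> (\<rho> i) = compose (fst B) ?\<psi> (\<rho> i)" if "i < p" for i
    using q(2) that \<rho>[OF that] by (fastforce simp: compose_def fun_eq_iff relmap_def)
  then have "\<forall>i<p. Comp ?C (vec p (\<lambda>i. (B, \<rho> i, Q)) $ i) (Q, ?\<phi>, ?X) =
      Comp ?C (vec p (\<lambda>i. (B, \<rho> i, Q)) $ i) (Q, ?\<psi>, ?X)"
    by (simp add: Comp_Rel)
  moreover have "(Q, ?\<phi>, ?X) \<in> Hom ?C ?X Q" "(Q, ?\<psi>, ?X) \<in> Hom ?C ?X Q"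
    by (rule Hom; use two in auto)+
  moreover have "?X \<in> Ob ?C" using two by simp
  ultimately have "(Q, ?\<phi>, ?X) = (Q, ?\<psi>, ?X)"
    using rel unfolding internal_relation_def by blast
  then have "?\<phi> = ?\<psi>" unfolding prod.inject by blast
  then have "?\<phi> q = ?\<psi> q" by (rule fun_cong)
  then show False using q(1) two(4) by simp
qed

text \<open>In the dual, a factorization of a column through the relation is an extension along the
  maps \<open>\<rho> i\<close>. In this form the triples are gone and only functions remain.\<close>

lemma closed_over_Rel:
  assumes BQX: "B \<in> Ob (Rel U n) \<inter> A" "Q \<in> Ob (Rel U n) \<inter> A" "X \<in> Ob (Rel U n) \<inter> A"
    and \<rho>: "\<And>i. i < dim_row M \<Longrightarrow> relmap B (\<rho> i) Q"
  shows "closed_over (dual (full_subcategory (Rel U n) A)) M B Q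
      (vec (dim_row M) (\<lambda>i. (B, \<rho> i, Q))) X \<longleftrightarrow>
    (\<forall>k>0. \<forall>f. M \<in> matr (dim_row M) (dim_col M) k \<longrightarrow> (\<forall>c<k. relmap B (f c) X) \<longrightarrow>
      (\<forall>j<dim_col M. \<exists>u. relmap Q u X \<and> (\<forall>i<dim_row M. \<forall>b\<in>fst B. u (\<rho> i b) = f (M $$ (i, j)) b)) \<longrightarrow>
      (\<exists>u. relmap Q u X \<and> (\<forall>i<dim_row M. \<forall>b\<in>fst B. u (\<rho> i b) = f 0 b)))"
    (is "closed_over ?C M B Q ?r X \<longleftrightarrow> ?R")
proof -
  have Comp: "Comp ?C (?r $ i) (Q, u, X) = (B, g, X) \<longleftrightarrow> (\<forall>b\<in>fst B. u (\<rho> i b) = g b)"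
    if "relmap B g X" "i < dim_row M" for u g i
  proof -
    have "g \<in> extensional (fst B)" using that by (auto simp: relmap_def PiE_def)
    then show ?thesis
      using that(2) by (auto simp: Comp_Rel compose_def fun_eq_iff extensional_def)
  qed
  have HomB: "g \<in> Hom ?C X B \<longleftrightarrow> (\<exists>\<phi>. g = (B, \<phi>, X) \<and> relmap B \<phi> X)" for g
    using BQX by (simp add: Hom_Rel)
  have HomQ: "g \<in> Hom ?C X Q \<longleftrightarrow> (\<exists>\<phi>. g = (Q, \<phi>, X) \<and> relmap Q \<phi> X)" for g
    using BQX by (simp add: Hom_Rel)
  have ex: "(\<exists>u\<in>Hom ?C X Q. \<forall>i<dim_row M. Comp ?C (?r $ i) u = (B, g i, X)) \<longleftrightarrow>
      (\<exists>u. relmap Q u X \<and> (\<forall>i<dim_row M. \<forall>b\<in>fst B. u (\<rho> i b) = g i b))"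
    if "\<And>i. i < dim_row M \<Longrightarrow> relmap B (g i) X" for g
    using Comp[OF that] unfolding Bex_def HomQ by auto
  show ?thesis
  proof
    assume clo: "closed_over ?C M B Q ?r X"
    show ?R
    proof (intro allI impI)
      fix k f assume k: "0 < (k :: nat)" and M: "M \<in> matr (dim_row M) (dim_col M) k"
        and f: "\<forall>c<k. relmap B (f c) X"
        and cols: "\<forall>j<dim_col M. \<exists>u. relmap Q u X \<and>
          (\<forall>i<dim_row M. \<forall>b\<in>fst B. u (\<rho> i b) = f (M $$ (i, j)) b)"
      have "\<exists>u\<in>Hom ?C X Q. \<forall>i<dim_row M. Comp ?C (?r $ i) u = (B, f 0, X)"
      proof (rule closed_overD[OF clo _ k M, where f="\<lambda>c. (B, f c, X)"])
        show "(\<lambda>c. (B, f c, X)) \<in> {..<k} \<rightarrow> Hom ?C X B" using f HomB by auto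
        fix j assume "j < dim_col M"
        then show "\<exists>u\<in>Hom ?C X Q. \<forall>i<dim_row M. Comp ?C (?r $ i) u = (B, f (M $$ (i, j)), X)"
          using cols ex f matr_entry[OF M] by simp
      qed simp
      then show "\<exists>u. relmap Q u X \<and> (\<forall>i<dim_row M. \<forall>b\<in>fst B. u (\<rho> i b) = f 0 b)"
        using ex[of "\<lambda>_. f 0"] f k by simp
    qed
  next
    assume R: ?R
    have dim: "dim_vec ?r = dim_row M" by simp
    show "closed_over ?C M B Q ?r X"
      unfolding closed_over_iff[OF dim]
    proof (intro allI ballI impI)
      fix k g assume k: "0 < (k :: nat)" and M: "M \<in> matr (dim_row M) (dim_col M) k"
        and g: "g \<in> {..<k} \<rightarrow> Hom ?C X B"
        and cols: "\<forall>j<dim_col M. \<exists>u\<in>Hom ?C X Q. \<forall>i<dim_row M. Comp ?C (?r $ i) u = g (M $$ (i, j))"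
      have "\<forall>c\<in>{..<k}. \<exists>\<phi>. g c = (B, \<phi>, X) \<and> relmap B \<phi> X"
        using g unfolding Pi_iff HomB by simp
      then obtain f where f: "\<And>c. c < k \<Longrightarrow> g c = (B, f c, X)" "\<And>c. c < k \<Longrightarrow> relmap B (f c) X"
        by (metis lessThan_iff)
      have "\<exists>u. relmap Q u X \<and> (\<forall>i<dim_row M. \<forall>b\<in>fst B. u (\<rho> i b) = f 0 b)"
      proof (rule R[rule_format, OF k M f(2)])
        fix j assume j: "j < dim_col M"
        have "\<exists>u\<in>Hom ?C X Q. \<forall>i<dim_row M. Comp ?C (?r $ i) u = (B, f (M $$ (i, j)), X)"
          using cols j f(1) matr_entry[OF M] by simp
        then show "\<exists>u. relmap Q u X \<and> (\<forall>i<dim_row M. \<forall>b\<in>fst B. u (\<rho> i b) = f (M $$ (i, j)) b)"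
          using ex[of "\<lambda>i. f (M $$ (i, j))"] f(2) j matr_entry[OF M] by simp
      qed
      then show "\<exists>u\<in>Hom ?C X Q. \<forall>i<dim_row M. Comp ?C (?r $ i) u = g 0"
        using ex[of "\<lambda>_. f 0"] f k by simp
    qed
  qed
qed

section \<open>Injective objects\<close>

definition rel_closed :: "nat mat set \<Rightarrow> nat \<Rightarrow> 'a set \<times> 'a vec set \<Rightarrow> bool" where
  "rel_closed S n X \<longleftrightarrow> (\<forall>M\<in>S. row_closed M 2 (fst X) (\<lambda>t. t 0 = t 1) \<and>
    row_closed M n (fst X) (\<lambda>t. vec n t \<in> snd X))"

lemma row_closed_eqD:
  assumes "row_closed M 2 X (\<lambda>t. t 0 = t 1)" and "k > 0" and "M \<in> matr (dim_row M) (dim_col M) k"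
    and "a < dim_row M" "b < dim_row M" and "x \<in> {..<k} \<rightarrow> X" "y \<in> {..<k} \<rightarrow> X"
    and "\<And>j. j < dim_col M \<Longrightarrow> x (M $$ (a, j)) = y (M $$ (b, j))"
  shows "x 0 = y 0"
  using row_closedD[OF assms(1-3), of "\<lambda>l. if l = 0 then a else b" "\<lambda>l. if l = 0 then x else y"]
    assms(4-) by simp

text \<open>Freed of categories, the extension problem is the same in \<open>Rel\<close> and in its
  full subcategory of injective objects, so one argument serves both; what has to be secured
  separately is surjectivity onto \<open>Q\<close>.\<close>

lemma row_closed_extension:
  assumes eq: "row_closed M 2 X (\<lambda>t. t 0 = t 1)" and rel: "row_closed M n X (\<lambda>t. vec n t \<in> V)"
    and k: "k > 0" and M: "M \<in> matr (dim_row M) (dim_col M) k"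
    and Q: "Q = (\<Union>i<dim_row M. \<rho> i ` B)" and T: "T \<subseteq> tuples n Q"
    and f: "\<And>c. c < k \<Longrightarrow> f c \<in> B \<rightarrow> X"
    and cols: "\<And>j. j < dim_col M \<Longrightarrow> \<exists>u. map_vec u ` T \<subseteq> V \<and>
      (\<forall>i<dim_row M. \<forall>b\<in>B. u (\<rho> i b) = f (M $$ (i, j)) b)"
  shows "\<exists>u. relmap (Q, T) u (X, V) \<and> (\<forall>i<dim_row M. \<forall>b\<in>B. u (\<rho> i b) = f 0 b)"
proof -
  have "\<forall>q\<in>Q. \<exists>i b. i < dim_row M \<and> b \<in> B \<and> \<rho> i b = q" using Q by auto
  then obtain i b where ib: "\<And>q. q \<in> Q \<Longrightarrow> i q < dim_row M" "\<And>q. q \<in> Q \<Longrightarrow> b q \<in> B"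
    "\<And>q. q \<in> Q \<Longrightarrow> \<rho> (i q) (b q) = q" by metis
  \<comment> \<open>The value at \<open>q\<close> is read off one chosen presentation
    \<open>\<rho> (i q) (b q)\<close> of \<open>q\<close>.\<close>
  define u where "u = restrict (\<lambda>q. f 0 (b q)) Q"
  have u: "u (\<rho> a c) = f 0 c" if ac: "a < dim_row M" "c \<in> B" for a c
  proof -
    define q where "q = \<rho> a c"
    have q: "q \<in> Q" using ac Q by (auto simp: q_def)
    \<comment> \<open>Two presentations of \<open>q\<close> give equal values in every left column,
      since both compute \<open>v q\<close>; closedness of equality carries this over to the right
      column.\<close>
    have "f 0 c = f 0 (b q)"
    proof (rule row_closed_eqD[OF eq k M, where x="\<lambda>e. f e c" and y="\<lambda>e. f e (b q)"])
      show "a < dim_row M" "i q < dim_row M" using ac ib[OF q] by auto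
      fix j assume "j < dim_col M"
      from cols[OF this] obtain v where
        v: "\<forall>i<dim_row M. \<forall>b\<in>B. v (\<rho> i b) = f (M $$ (i, j)) b" by auto
      show "f (M $$ (a, j)) c = f (M $$ (i q, j)) (b q)"
        using v ac ib[OF q] q_def by metis
    qed (use f ac ib[OF q] in \<open>auto simp: Pi_iff\<close>)
    then show ?thesis using q by (simp add: u_def flip: q_def)
  qed
  have "map_vec u t \<in> V" if "t \<in> T" for t
  proof -
    have t: "dim_vec t = n" "\<And>l. l < n \<Longrightarrow> t $ l \<in> Q" using that T by (auto simp: tuples_iff)
    \<comment> \<open>The coordinates of \<open>t\<close> may come from different rows and different
      points of \<open>B\<close>: the coordinate \<open>l\<close> uses the row
      \<open>i (t $ l)\<close> and the family of values at \<open>b (t $ l)\<close>. This is why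
      rows and families are chosen per coordinate.\<close>
    have "vec n (\<lambda>l. f 0 (b (t $ l))) \<in> V"
    proof (rule row_closedD[OF rel k M, where x="\<lambda>l e. f e (b (t $ l))" and a="\<lambda>l. i (t $ l)"])
      fix j assume "j < dim_col M"
      from cols[OF this] obtain v where v: "map_vec v ` T \<subseteq> V"
        "\<forall>i<dim_row M. \<forall>b\<in>B. v (\<rho> i b) = f (M $$ (i, j)) b" by auto
      have "v (t $ l) = f (M $$ (i (t $ l), j)) (b (t $ l))" if "l < n" for l
        using v(2) ib[OF t(2)[OF that]] by metis
      then have "vec n (\<lambda>l. f (M $$ (i (t $ l), j)) (b (t $ l))) = map_vec v t"
        using t by auto
      then show "vec n (\<lambda>l. f (M $$ (i (t $ l), j)) (b (t $ l))) \<in> V" using v(1) that by auto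
    qed (use f ib t in \<open>auto simp: Pi_iff\<close>)
    also have "vec n (\<lambda>l. f 0 (b (t $ l))) = map_vec u t" using t by (auto simp: u_def)
    finally show ?thesis .
  qed
  moreover have "u \<in> Q \<rightarrow>\<^sub>E X" using f[OF k] ib by (auto simp: u_def)
  ultimately show ?thesis using u by (auto simp: relmap_def)
qed

text \<open>Injectivity is applied to the simplest \<open>B\<close>, consisting of \<open>s\<close>
  points and no tuples, so that every choice of values \<open>x b c\<close> is a morphism. Then
  \<open>Q\<close> can be any quotient of \<open>dim_row M\<close> copies of \<open>B\<close>, with
  any tuples \<open>T\<close>, its points being coded by natural numbers.\<close>

lemma injective_object_test:
  fixes U :: "'u set set"
  assumes U: "set_universe U" and inj: "injective_object (Rel U n) S X" and MS: "M \<in> S"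
    and k: "k > 0" and M: "M \<in> matr (dim_row M) (dim_col M) k"
    and T: "T \<subseteq> tuples n (\<Union>i<dim_row M. \<rho> i ` {..<s :: nat})"
    and x: "\<And>b c. b < s \<Longrightarrow> c < k \<Longrightarrow> x b c \<in> fst X"
    and cols: "\<And>j. j < dim_col M \<Longrightarrow> \<exists>v. (\<forall>i<dim_row M. \<forall>b<s. v (\<rho> i b) = x b (M $$ (i, j))) \<and>
      map_vec v ` T \<subseteq> snd X"
  shows "\<exists>v. (\<forall>i<dim_row M. \<forall>b<s. v (\<rho> i b :: nat) = x b 0) \<and> map_vec v ` T \<subseteq> snd X"
proof -
  let ?p = "dim_row M"
  let ?Q = "\<Union>i<?p. \<rho> i ` {..<s}"
  obtain g :: "nat \<Rightarrow> 'u" where g: "inj g" "\<And>A. g ` A \<in> U"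
    using set_universe_nat[OF U] by metis
  define d where "d = inv_into UNIV g"
  have d: "d (g m) = m" for m using g(1) by (simp add: d_def)
  have gQ: "g (\<rho> i b) \<in> g ` ?Q" if "i < ?p" "b < s" for i b
    using that by (intro imageI UN_I) auto
  define B where "B = (g ` {..<s}, {} :: 'u vec set)"
  define Q where "Q = (g ` ?Q, map_vec g ` T)"
  define r where "r i = restrict (\<lambda>y. g (\<rho> i (d y))) (g ` {..<s})" for i
  \<comment> \<open>\<open>Rel U n\<close> is treated as the full subcategory on
    \<open>UNIV\<close>, so that the lemmas on full subcategories apply to it.\<close>
  have B: "B \<in> Ob (Rel U n) \<inter> UNIV" using g by (simp add: B_def Ob_Rel)
  have Q: "Q \<in> Ob (Rel U n) \<inter> UNIV"
    using g T by (auto simp: Q_def Ob_Rel tuples_iff)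
  have X: "X \<in> Ob (Rel U n) \<inter> UNIV" using inj by (simp add: injective_object_def)
  have r: "relmap B (r i) Q" if "i < ?p" for i
    using that by (auto simp: relmap_def B_def Q_def r_def d gQ)
  have "internal_relation (dual (full_subcategory (Rel U n) UNIV)) ?p B Q (vec ?p (\<lambda>i. (B, r i, Q)))"
    by (rule Rel_internal_relationI[OF B Q r]) (auto simp: B_def Q_def r_def d image_image image_UN)
  then have clo: "closed_over (dual (full_subcategory (Rel U n) UNIV)) M B Q (vec ?p (\<lambda>i. (B, r i, Q))) X"
    using inj MS unfolding injective_object_def full_subcategory_UNIV by blast
  define f where "f c = restrict (\<lambda>y. x (d y) c) (g ` {..<s})" for c
  have "\<exists>u. relmap Q u X \<and> (\<forall>i<?p. \<forall>b\<in>fst B. u (r i b) = f 0 b)"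
  proof (rule closed_over_Rel[OF B Q X r, THEN iffD1, OF _ clo, rule_format, OF _ k M])
    fix c assume "c < k"
    then show "relmap B (f c) X" using x by (auto simp: relmap_def B_def f_def d)
  next
    fix j assume j: "j < dim_col M"
    from cols[OF j] obtain v where v: "\<forall>i<?p. \<forall>b<s. v (\<rho> i b) = x b (M $$ (i, j))"
      "map_vec v ` T \<subseteq> snd X" by blast
    define u where "u = restrict (\<lambda>y. v (d y)) (g ` ?Q)"
    have "map_vec u (map_vec g t) = map_vec v t" if "t \<in> T" for t
      using T that by (intro eq_vecI) (auto simp: tuples_iff u_def d)
    then have "relmap Q u X"
      using v x matr_entry[OF M _ j] by (auto simp: relmap_def Q_def u_def d)
    moreover have "u (r i b) = f (M $$ (i, j)) b" if "i < ?p" "b \<in> fst B" for i b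
      using that v(1) gQ by (auto simp: u_def r_def f_def B_def d)
    ultimately show "\<exists>u. relmap Q u X \<and> (\<forall>i<?p. \<forall>b\<in>fst B. u (r i b) = f (M $$ (i, j)) b)"
      by blast
  qed
  then obtain u where u: "relmap Q u X" "\<And>i b. i < ?p \<Longrightarrow> b \<in> fst B \<Longrightarrow> u (r i b) = f 0 b" by blast
  have "map_vec (u \<circ> g) t = map_vec u (map_vec g t)" for t by auto
  then have "map_vec (u \<circ> g) ` T \<subseteq> snd X" using u(1) by (auto simp: relmap_def Q_def)
  moreover have "(u \<circ> g) (\<rho> i b) = x b 0" if "i < ?p" "b < s" for i b
    using u(2)[OF that(1), of "g b"] that by (auto simp: r_def B_def f_def d)
  ultimately show ?thesis by blast
qed

text \<open>Necessity uses two kinds of test object: copies of two points with one pair of points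
  glued, for equality, and copies of \<open>n\<close> points with a single tuple, for the relation.
  Sufficiency solves the extension problem, an infinite set with all tuples guaranteeing
  surjectivity.\<close>

lemma injective_object_iff:
  assumes U: "set_universe U"
  shows "injective_object (Rel U n) S X \<longleftrightarrow> X \<in> Ob (Rel U n) \<and> rel_closed S n X"
proof (intro iffI conjI)
  assume inj: "injective_object (Rel U n) S X"
  then show "X \<in> Ob (Rel U n)" by (simp add: injective_object_def)
  show "rel_closed S n X"
    unfolding rel_closed_def
  proof (intro ballI conjI)
    fix M assume MS: "M \<in> S"
    let ?p = "dim_row M"
    show "row_closed M 2 (fst X) (\<lambda>t. t 0 = t 1)"
    proof (rule row_closedI)
      fix k :: nat and a :: "nat \<Rightarrow> nat" and x :: "nat \<Rightarrow> nat \<Rightarrow> 'a"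
      assume k: "k > 0" and M: "M \<in> matr ?p (dim_col M) k"
        and a: "a \<in> {..<2} \<rightarrow> {..<?p}" and x: "x \<in> {..<2} \<rightarrow> {..<k} \<rightarrow> fst X"
        and cols: "\<And>j. j < dim_col M \<Longrightarrow> x 0 (M $$ (a 0, j)) = x 1 (M $$ (a 1, j))"
      \<comment> \<open>The set \<open>?p \<times> 2\<close>, coded by \<open>(i, b) \<mapsto> 2 * i + b\<close>, with \<open>(a 1, 1)\<close> glued to \<open>(a 0, 0)\<close>.\<close>
      define \<rho> where "\<rho> i b = (if i = a 1 \<and> b = 1 then 2 * a 0 else 2 * i + b)" for i b :: nat
      have ap: "a 0 < ?p" "a 1 < ?p" using a by auto
      have "\<exists>v. (\<forall>i<?p. \<forall>b<2. v (\<rho> i b) = x b 0) \<and> map_vec v ` {} \<subseteq> snd X"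
      proof (rule injective_object_test[OF U inj MS k M])
        fix j assume j: "j < dim_col M"
        \<comment> \<open>Decoding by \<open>div\<close> and \<open>mod\<close> yields the
          prescribed values; at the glued point the two candidates agree by the assumption on column
          \<open>j\<close>.\<close>
        have "x ((\<rho> i b) mod 2) (M $$ ((\<rho> i b) div 2, j)) = x b (M $$ (i, j))" if "b < 2" for i b
          using that cols[OF j] by (auto simp: \<rho>_def)
        then show "\<exists>v. (\<forall>i<?p. \<forall>b<2. v (\<rho> i b) = x b (M $$ (i, j))) \<and> map_vec v ` {} \<subseteq> snd X"
          by (intro exI[of _ "\<lambda>q. x (q mod 2) (M $$ (q div 2, j))"]) auto
      qed (use x in \<open>auto simp: Pi_iff\<close>)
      then obtain v where v: "\<And>i b. i < ?p \<Longrightarrow> b < 2 \<Longrightarrow> v (\<rho> i b) = x b 0" by blast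
      have "\<rho> (a 0) 0 = \<rho> (a 1) 1" by (simp add: \<rho>_def)
      then show "x 0 0 = x 1 0" using v[OF ap(1), of 0] v[OF ap(2), of 1] by simp
    qed
    show "row_closed M n (fst X) (\<lambda>t. vec n t \<in> snd X)"
    proof (rule row_closedI)
      fix k :: nat and a :: "nat \<Rightarrow> nat" and x :: "nat \<Rightarrow> nat \<Rightarrow> 'a"
      assume k: "k > 0" and M: "M \<in> matr ?p (dim_col M) k"
        and a: "a \<in> {..<n} \<rightarrow> {..<?p}" and x: "x \<in> {..<n} \<rightarrow> {..<k} \<rightarrow> fst X"
        and cols: "\<And>j. j < dim_col M \<Longrightarrow> vec n (\<lambda>l. x l (M $$ (a l, j))) \<in> snd X"
      \<comment> \<open>Here nothing is glued. The only tuple \<open>?t\<close> takes as its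
        coordinate \<open>l\<close> the point \<open>l\<close> of the copy numbered
        \<open>a l\<close>.\<close>
      define \<rho> where "\<rho> i b = n * i + b" for i b :: nat
      have \<rho>: "\<rho> i b mod n = b" "\<rho> i b div n = i" if "b < n" for i b
        using that by (auto simp: \<rho>_def)
      let ?t = "vec n (\<lambda>l. \<rho> (a l) l)"
      have "\<exists>v. (\<forall>i<?p. \<forall>b<n. v (\<rho> i b) = x b 0) \<and> map_vec v ` {?t} \<subseteq> snd X"
      proof (rule injective_object_test[OF U inj MS k M])
        show "{?t} \<subseteq> tuples n (\<Union>i<?p. \<rho> i ` {..<n})" using a by (auto simp: tuples_iff)
        fix j assume j: "j < dim_col M"
        let ?v = "\<lambda>q. x (q mod n) (M $$ (q div n, j))"
        have "map_vec ?v ?t = vec n (\<lambda>l. x l (M $$ (a l, j)))" by (auto simp: \<rho>)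
        then show "\<exists>v. (\<forall>i<?p. \<forall>b<n. v (\<rho> i b) = x b (M $$ (i, j))) \<and> map_vec v ` {?t} \<subseteq> snd X"
          using cols[OF j] by (intro exI[of _ ?v]) (simp add: \<rho>)
      qed (use x in \<open>auto simp: Pi_iff\<close>)
      then obtain v where v: "\<And>i b. i < ?p \<Longrightarrow> b < n \<Longrightarrow> v (\<rho> i b) = x b 0" "map_vec v ?t \<in> snd X"
        by blast
      moreover have "map_vec v ?t = vec n (\<lambda>l. x l 0)"
        using v(1) a by (intro eq_vecI) (auto simp: Pi_iff)
      ultimately show "vec n (\<lambda>l. x l 0) \<in> snd X" by simp
    qed
  qed
next
  assume "X \<in> Ob (Rel U n) \<and> rel_closed S n X"
  then have X: "X \<in> Ob (Rel U n) \<inter> UNIV" and clo: "rel_closed S n X" by auto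
  show "injective_object (Rel U n) S X"
    unfolding injective_object_def
  proof (intro conjI ballI allI impI)
    fix M B Q r assume MS: "M \<in> S" and "internal_relation (dual (Rel U n)) (dim_row M) B Q r"
    then have rel: "internal_relation (dual (full_subcategory (Rel U n) UNIV)) (dim_row M) B Q r"
      by simp
    then obtain \<rho> where r: "r = vec (dim_row M) (\<lambda>i. (B, \<rho> i, Q))"
      and \<rho>: "\<And>i. i < dim_row M \<Longrightarrow> relmap B (\<rho> i) Q"
      and B: "B \<in> Ob (Rel U n) \<inter> UNIV" and Q: "Q \<in> Ob (Rel U n) \<inter> UNIV"
      by (metis Rel_internal_relationD)
    obtain g :: "nat \<Rightarrow> 'a" where g: "inj g" "\<And>A. g ` A \<in> U"
      using set_universe_nat[OF U] by metis
    have surj: "fst Q = (\<Union>i<dim_row M. \<rho> i ` fst B)"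
      by (rule Rel_internal_relation_surj[OF rel[unfolded r] \<rho>, of "range g" "g 0" "g 1"])
        (use g in \<open>auto simp: Ob_Rel inj_eq\<close>)
    have "closed_over (dual (full_subcategory (Rel U n) UNIV)) M B Q r X"
      unfolding r
    proof (rule closed_over_Rel[OF B Q X \<rho>, THEN iffD2], assumption, intro allI impI)
      fix k f assume k: "0 < (k :: nat)" and M: "M \<in> matr (dim_row M) (dim_col M) k"
        and f: "\<forall>c<k. relmap B (f c) X"
        and cols: "\<forall>j<dim_col M. \<exists>u. relmap Q u X \<and>
          (\<forall>i<dim_row M. \<forall>b\<in>fst B. u (\<rho> i b) = f (M $$ (i, j)) b)"
      have "\<exists>u. relmap (fst Q, snd Q) u (fst X, snd X) \<and>
          (\<forall>i<dim_row M. \<forall>b\<in>fst B. u (\<rho> i b) = f 0 b)"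
      proof (rule row_closed_extension[OF _ _ k M surj])
        show "snd Q \<subseteq> tuples n (fst Q)" using Q by (simp add: Ob_Rel)
        show "f c \<in> fst B \<rightarrow> fst X" if "c < k" for c using f that by (auto simp: relmap_def)
        fix j assume "j < dim_col M"
        with cols show "\<exists>u. map_vec u ` snd Q \<subseteq> snd X \<and>
            (\<forall>i<dim_row M. \<forall>b\<in>fst B. u (\<rho> i b) = f (M $$ (i, j)) b)"
          unfolding relmap_def by blast
      qed (use clo MS in \<open>auto simp: rel_closed_def\<close>)
      then show "\<exists>u. relmap Q u X \<and> (\<forall>i<dim_row M. \<forall>b\<in>fst B. u (\<rho> i b) = f 0 b)" by simp
    qed
    then show "closed_over (dual (Rel U n)) M B Q r X" by simp
  qed (use X in simp)
qed

section \<open>Colimits of injective objects\<close>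

text \<open>This is the image of \<open>Z\<close> in the product of all targets in \<open>H\<close>,
  built without the product, which might not lie in the universe. Points are identified when every
  \<open>h\<close> identifies them, and tuples are related when every \<open>h\<close> makes them
  related, so the Horn conditions are inherited from the targets.\<close>

lemma rel_quotient:
  fixes Z :: "'z set" and H :: "(('z \<Rightarrow> 'u) \<times> 'u rel_ob) set"
  assumes U: "set_universe U" and W: "W \<in> U" "Z \<lesssim> W"
    and H: "\<And>h P. (h, P) \<in> H \<Longrightarrow> h \<in> Z \<rightarrow> fst P \<and> rel_closed S n P"
  obtains e :: "'z \<Rightarrow> 'u" and L where "L \<in> Ob (Rel U n)" and "rel_closed S n L" and "fst L = e ` Z"
    and "\<And>z z'. z \<in> Z \<Longrightarrow> z' \<in> Z \<Longrightarrow> e z = e z' \<longleftrightarrow> (\<forall>(h, P)\<in>H. h z = h z')"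
    and "\<And>t. t \<in> tuples n Z \<Longrightarrow> map_vec e t \<in> snd L \<longleftrightarrow> (\<forall>(h, P)\<in>H. map_vec h t \<in> snd P)"
    and "\<And>h P. (h, P) \<in> H \<Longrightarrow> \<exists>u. relmap L u P \<and> (\<forall>z\<in>Z. u (e z) = h z)"
proof -
  obtain i where i: "inj_on i Z" "i ` Z \<subseteq> W" using W(2) by (auto simp: lepoll_def)
  \<comment> \<open>A canonical representative of the class of \<open>z\<close>: the predicate under
    \<open>SOME\<close> is the same for equivalent points, hence so is the choice.\<close>
  define c where "c z = (SOME z'. z' \<in> Z \<and> (\<forall>(h, P)\<in>H. h z' = h z))" for z
  have c: "c z \<in> Z" "\<And>h P. (h, P) \<in> H \<Longrightarrow> h (c z) = h z" if "z \<in> Z" for z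
  proof -
    have "c z \<in> Z \<and> (\<forall>(h, P)\<in>H. h (c z) = h z)"
      unfolding c_def by (rule someI[of _ z]) (use that in auto)
    then show "c z \<in> Z" "\<And>h P. (h, P) \<in> H \<Longrightarrow> h (c z) = h z" by auto
  qed
  define e where "e z = i (c z)" for z
  have e_iff: "e z = e z' \<longleftrightarrow> (\<forall>(h, P)\<in>H. h z = h z')" if "z \<in> Z" "z' \<in> Z" for z z'
  proof
    assume "e z = e z'"
    then have "c z = c z'" using i(1) c(1) that by (simp add: e_def inj_on_eq_iff)
    then have "h z = h z'" if "(h, P) \<in> H" for h P
      using c(2)[OF \<open>z \<in> Z\<close> that] c(2)[OF \<open>z' \<in> Z\<close> that] by simp
    then show "\<forall>(h, P)\<in>H. h z = h z'" by auto
  next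
    assume "\<forall>(h, P)\<in>H. h z = h z'"
    then have "(\<lambda>y. y \<in> Z \<and> (\<forall>(h, P)\<in>H. h y = h z)) = (\<lambda>y. y \<in> Z \<and> (\<forall>(h, P)\<in>H. h y = h z'))"
      by (intro ext) (auto 0 3)
    then show "e z = e z'" by (simp add: e_def c_def)
  qed
  define L where "L = (e ` Z, {map_vec e t |t. t \<in> tuples n Z \<and> (\<forall>(h, P)\<in>H. map_vec h t \<in> snd P)})"
  define s where "s = inv_into Z e"
  have s: "s y \<in> Z" "e (s y) = y" if "y \<in> e ` Z" for y
    using that by (auto simp: s_def intro: inv_into_into f_inv_into_f)
  have hs: "h (s (e z)) = h z" if "z \<in> Z" "(h, P) \<in> H" for z h P
    using s[of "e z"] e_iff[of "s (e z)" z] that by auto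
  have e_snd: "map_vec e t \<in> snd L \<longleftrightarrow> (\<forall>(h, P)\<in>H. map_vec h t \<in> snd P)" if t: "t \<in> tuples n Z" for t
  proof
    assume "map_vec e t \<in> snd L"
    then obtain t' where t': "map_vec e t = map_vec e t'" "t' \<in> tuples n Z" "\<forall>(h, P)\<in>H. map_vec h t' \<in> snd P"
      by (auto simp: L_def)
    \<comment> \<open>A tuple of \<open>L\<close> may come from several tuples over
      \<open>Z\<close>, but no \<open>h\<close> tells them apart.\<close>
    have "map_vec h t = map_vec h t'" if "(h, P) \<in> H" for h P
    proof (rule eq_vecI)
      fix l assume l: "l < dim_vec (map_vec h t')"
      then have "t $ l \<in> Z" "t' $ l \<in> Z" using t t'(2) by (auto simp: tuples_iff)
      moreover have "e (t $ l) = e (t' $ l)"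
        using arg_cong[OF t'(1), of "\<lambda>v. v $ l"] l t t'(2) by (simp add: tuples_iff)
      ultimately have "h (t $ l) = h (t' $ l)" using e_iff that by blast
      then show "map_vec h t $ l = map_vec h t' $ l" using l t t'(2) by (simp add: tuples_iff)
    qed (use t t'(2) in \<open>simp add: tuples_iff\<close>)
    then show "\<forall>(h, P)\<in>H. map_vec h t \<in> snd P" using t'(3) by fastforce
  next
    assume "\<forall>(h, P)\<in>H. map_vec h t \<in> snd P"
    then show "map_vec e t \<in> snd L" using t by (auto simp: L_def)
  qed
  have "L \<in> Ob (Rel U n)"
  proof -
    have "e ` Z \<subseteq> W" using c(1) i(2) by (auto simp: e_def)
    then show ?thesis
      using set_universe_subset[OF U W(1)] by (auto simp: Ob_Rel L_def tuples_iff)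
  qed
  \<comment> \<open>Through the section \<open>s\<close> of \<open>e\<close>, equality and the
    relation on \<open>L\<close> are intersections of preimages along the maps
    \<open>h \<circ> s\<close>.\<close>
  moreover have "rel_closed S n L"
    unfolding rel_closed_def
  proof (intro ballI conjI)
    fix M assume M: "M \<in> S"
    show "row_closed M 2 (fst L) (\<lambda>t. t 0 = t 1)"
    proof (rule row_closed_INT_vimage[where H=H and Y="\<lambda>x. fst (snd x)" and f="\<lambda>x. fst x \<circ> s"])
      fix t :: "nat \<Rightarrow> 'u" assume "t \<in> {..<2} \<rightarrow> fst L"
      then have "t 0 \<in> e ` Z" "t 1 \<in> e ` Z" by (auto simp: L_def)
      then show "t 0 = t 1 \<longleftrightarrow> (\<forall>x\<in>H. ((fst x \<circ> s) \<circ> t) 0 = ((fst x \<circ> s) \<circ> t) 1)"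
        using e_iff[of "s (t 0)" "s (t 1)"] s by (auto simp: case_prod_beta)
    next
      fix x assume "x \<in> H"
      then show "row_closed M 2 (fst (snd x)) (\<lambda>t. t 0 = t 1)" "fst x \<circ> s \<in> fst L \<rightarrow> fst (snd x)"
        using H[of "fst x" "snd x"] M s by (auto simp: rel_closed_def L_def)
    qed
    show "row_closed M n (fst L) (\<lambda>t. vec n t \<in> snd L)"
    proof (rule row_closed_INT_vimage[where H=H and Y="\<lambda>x. fst (snd x)" and f="\<lambda>x. fst x \<circ> s"])
      fix t :: "nat \<Rightarrow> 'u" assume t: "t \<in> {..<n} \<rightarrow> fst L"
      then have tl: "t l \<in> e ` Z" if "l < n" for l using that by (auto simp: L_def)
      have "vec n t = map_vec e (vec n (s \<circ> t))" using s(2)[OF tl] by (intro eq_vecI) auto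
      moreover have "vec n (s \<circ> t) \<in> tuples n Z" using s(1)[OF tl] by (auto simp: tuples_iff)
      moreover have "map_vec h (vec n (s \<circ> t)) = vec n ((h \<circ> s) \<circ> t)" for h :: "'z \<Rightarrow> 'u" by auto
      ultimately show "vec n t \<in> snd L \<longleftrightarrow> (\<forall>x\<in>H. vec n ((fst x \<circ> s) \<circ> t) \<in> snd (snd x))"
        using e_snd[of "vec n (s \<circ> t)"] by (simp add: case_prod_beta)
    next
      fix x assume "x \<in> H"
      then show "row_closed M n (fst (snd x)) (\<lambda>t. vec n t \<in> snd (snd x))"
        "fst x \<circ> s \<in> fst L \<rightarrow> fst (snd x)"
        using H[of "fst x" "snd x"] M s by (auto simp: rel_closed_def L_def)
    qed
  qed
  moreover have "\<exists>u. relmap L u P \<and> (\<forall>z\<in>Z. u (e z) = h z)" if hP: "(h, P) \<in> H" for h P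
  proof (intro exI conjI ballI)
    let ?u = "restrict (h \<circ> s) (e ` Z)"
    have "map_vec ?u (map_vec e t) = map_vec h t" if "t \<in> tuples n Z" for t
      using that hs hP by (intro eq_vecI) (auto simp: tuples_iff)
    moreover have "?u \<in> e ` Z \<rightarrow>\<^sub>E fst P" using H[OF hP] s by auto
    ultimately show "relmap L ?u P" using hP by (auto simp: relmap_def L_def)
    show "?u (e z) = h z" if "z \<in> Z" for z using hs that hP by simp
  qed
  moreover have "fst L = e ` Z" by (simp add: L_def)
  ultimately show thesis using that e_iff e_snd by blast
qed

lemma Sigma_lepoll_infinite:
  assumes "infinite W" "I \<lesssim> W" "\<And>i. i \<in> I \<Longrightarrow> A i \<lesssim> W"
  shows "Sigma I A \<lesssim> W"
  using card_of_Sigma_ordLeq_infinite[of W I A] assms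
  by (simp add: lepoll_def flip: card_of_ordLeq)

text \<open>Limits in the dual are colimits of injective objects, obtained as the universal quotient
  of the disjoint union under all cocones with injective vertex. Each cocone is itself a member of
  \<open>H\<close> and so factors through the quotient, uniquely because \<open>e\<close> maps
  \<open>Z\<close> onto \<open>L\<close>.\<close>

lemma finitely_complete_dual_Inj:
  fixes U :: "'u set set"
  assumes U: "set_universe U"
  shows "finitely_complete (dual (Inj S (Rel U n)))"
  unfolding finitely_complete_def
proof (intro conjI allI impI)
  define A where "A = {X. injective_object (Rel U n) S X}"
  have A: "X \<in> A \<longleftrightarrow> X \<in> Ob (Rel U n) \<and> rel_closed S n X" for X
    by (simp add: A_def injective_object_iff[OF U])
  let ?F = "full_subcategory (Rel U n) A"
  have Inj: "Inj S (Rel U n) = ?F" by (simp add: Inj_def A_def)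
  show "category (dual (Inj S (Rel U n)))"
    unfolding Inj by (intro category_dual category_full_subcategory category_Rel)
  fix J :: "(nat, nat) cat" and Fo Fa
  assume *: "category J \<and> finite (Ob J) \<and> finite (Arr J) \<and> is_functor J (dual (Inj S (Rel U n))) Fo Fa"
  then interpret J: category J by simp
  have F: "is_functor J (dual ?F) Fo Fa" using * by (simp add: Inj)
  have FoA: "Fo i \<in> A" "Fo i \<in> Ob (Rel U n)" if "i \<in> Ob J" for i
    using F that by (auto simp: is_functor_def)
  have "\<forall>a\<in>Arr J. \<exists>\<phi>. Fa a = (Fo (Cod J a), \<phi>, Fo (Dom J a)) \<and> relmap (Fo (Cod J a)) \<phi> (Fo (Dom J a))"
  proof
    fix a assume "a \<in> Arr J"
    then have "Fa a \<in> Hom ?F (Fo (Cod J a)) (Fo (Dom J a))" using F by (simp add: is_functor_def)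
    then show "\<exists>\<phi>. Fa a = (Fo (Cod J a), \<phi>, Fo (Dom J a)) \<and> relmap (Fo (Cod J a)) \<phi> (Fo (Dom J a))"
      by (auto dest!: Hom_full_subcategory_subset simp: Hom_Rel)
  qed
  then obtain \<alpha> where Fa: "\<And>a. a \<in> Arr J \<Longrightarrow> Fa a = (Fo (Cod J a), \<alpha> a, Fo (Dom J a))"
    and \<alpha>: "\<And>a. a \<in> Arr J \<Longrightarrow> relmap (Fo (Cod J a)) (\<alpha> a) (Fo (Dom J a))"
    by metis
  define Z where "Z = Sigma (Ob J) (\<lambda>i. fst (Fo i))"
  \<comment> \<open>The disjoint union has to embed into a member of the universe. The union of the
    finitely many underlying sets with an infinite set is large enough to contain a copy of a finite
    sum of its subsets.\<close>
  obtain W where W: "W \<in> U" "Z \<lesssim> W"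
  proof -
    obtain V where V: "V \<in> U" "infinite V" using U by (auto simp: set_universe_def)
    have "\<exists>W\<in>U. V \<subseteq> W \<and> (\<forall>i\<in>I. fst (Fo i) \<subseteq> W)" if "finite I" "I \<subseteq> Ob J" for I
      using that
    proof (induction I rule: finite_induct)
      case (insert i I)
      then obtain W where "W \<in> U" "V \<subseteq> W" "\<forall>i\<in>I. fst (Fo i) \<subseteq> W" by auto
      moreover have "fst (Fo i) \<in> U" using FoA[of i] insert.prems by (auto simp: Ob_Rel)
      ultimately show ?case
        using U by (intro bexI[of _ "W \<union> fst (Fo i)"]) (auto simp: set_universe_def)
    qed (use V in auto)
    then obtain W where W: "W \<in> U" "V \<subseteq> W" "\<forall>i\<in>Ob J. fst (Fo i) \<subseteq> W" using * by blast
    have "infinite W" using V W finite_subset by blast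
    then have "Z \<lesssim> W"
      unfolding Z_def using finite_lepoll_infinite * W(3)
      by (intro Sigma_lepoll_infinite) (auto intro: subset_imp_lepoll)
    then show thesis using that W(1) by blast
  qed
  \<comment> \<open>The dual reverses arrows: \<open>\<alpha> a\<close> goes from
    \<open>Fo (Cod J a)\<close> to \<open>Fo (Dom J a)\<close>. Thus the last condition is the
    compatibility of a cocone, and the preceding one says that its components preserve the
    relations.\<close>
  define H where "H = {(h, P). P \<in> A \<and> h \<in> Z \<rightarrow> fst P \<and>
    (\<forall>i\<in>Ob J. \<forall>t\<in>snd (Fo i). map_vec (\<lambda>x. h (i, x)) t \<in> snd P) \<and>
    (\<forall>a\<in>Arr J. \<forall>x\<in>fst (Fo (Cod J a)). h (Dom J a, \<alpha> a x) = h (Cod J a, x))}"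
  obtain e L where L: "L \<in> Ob (Rel U n)" "rel_closed S n L" and fstL: "fst L = e ` Z"
    and e_eq: "\<And>z z'. z \<in> Z \<Longrightarrow> z' \<in> Z \<Longrightarrow> e z = e z' \<longleftrightarrow> (\<forall>(h, P)\<in>H. h z = h z')"
    and e_snd: "\<And>t. t \<in> tuples n Z \<Longrightarrow> map_vec e t \<in> snd L \<longleftrightarrow> (\<forall>(h, P)\<in>H. map_vec h t \<in> snd P)"
    and ex: "\<And>h P. (h, P) \<in> H \<Longrightarrow> \<exists>u. relmap L u P \<and> (\<forall>z\<in>Z. u (e z) = h z)"
  proof (rule rel_quotient[OF U W, of H S n])
    show "h \<in> Z \<rightarrow> fst P \<and> rel_closed S n P" if "(h, P) \<in> H" for h P
      using that by (simp add: H_def A)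
  qed (rule that)
  define \<pi> where "\<pi> i = restrict (\<lambda>x. e (i, x)) (fst (Fo i))" for i
  have LA: "L \<in> A" using L A by simp
  have \<pi>: "relmap (Fo i) (\<pi> i) L" if i: "i \<in> Ob J" for i
  proof -
    have "map_vec (\<pi> i) t \<in> snd L" if t: "t \<in> snd (Fo i)" for t
    proof -
      have t': "t \<in> tuples n (fst (Fo i))" using t FoA[OF i] by (auto simp: Ob_Rel)
      then have "map_vec (\<pi> i) t = map_vec e (map_vec (Pair i) t)"
        by (intro eq_vecI) (auto simp: tuples_iff \<pi>_def)
      moreover have "map_vec (Pair i) t \<in> tuples n Z" using t' i by (auto simp: tuples_iff Z_def)
      moreover have "map_vec h (map_vec (Pair i) t) \<in> snd P" if "(h, P) \<in> H" for h P
      proof -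
        have "map_vec h (map_vec (Pair i) t) = map_vec (\<lambda>x. h (i, x)) t" by auto
        then show ?thesis using that i t unfolding H_def by auto
      qed
      ultimately show ?thesis using e_snd by auto
    qed
    then show ?thesis using i by (auto simp: relmap_def fstL \<pi>_def Z_def)
  qed
  have Hom\<pi>: "(Fo i, \<pi> i, L) \<in> Hom ?F (Fo i) L" if "i \<in> Ob J" for i
    using \<pi>[OF that] FoA[OF that] L LA by (simp add: Hom_Rel)
  have "is_limit J (dual ?F) Fo Fa L (\<lambda>i. (Fo i, \<pi> i, L))"
    unfolding is_limit_def
  proof (intro conjI allI impI)
    show "is_cone J (dual ?F) Fo Fa L (\<lambda>i. (Fo i, \<pi> i, L))"
      unfolding is_cone_def
    proof (intro conjI ballI)
      fix a assume a: "a \<in> Arr J"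
      have "compose (fst (Fo (Cod J a))) (\<pi> (Dom J a)) (\<alpha> a) = \<pi> (Cod J a)"
      proof
        fix x
        show "compose (fst (Fo (Cod J a))) (\<pi> (Dom J a)) (\<alpha> a) x = \<pi> (Cod J a) x"
        proof (cases "x \<in> fst (Fo (Cod J a))")
          case True
          then have "\<alpha> a x \<in> fst (Fo (Dom J a))" using \<alpha>[OF a] by (auto simp: relmap_def)
          \<comment> \<open>Every member of \<open>H\<close> identifies these two points, hence
            \<open>e\<close> does.\<close>
          moreover from this True have "e (Dom J a, \<alpha> a x) = e (Cod J a, x)"
            using e_eq J.Dom_Ob[OF a] J.Cod_Ob[OF a] a by (auto simp: Z_def H_def)
          ultimately show ?thesis using True by (simp add: compose_def \<pi>_def)
        qed (simp add: compose_def \<pi>_def)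
      qed
      then show "Comp (dual ?F) (Fa a) (Fo (Dom J a), \<pi> (Dom J a), L) = (Fo (Cod J a), \<pi> (Cod J a), L)"
        by (simp add: Fa[OF a] Comp_Rel)
    qed (use L LA Hom\<pi> in simp_all)
  next
    fix L' p' assume cone: "is_cone J (dual ?F) Fo Fa L' p'"
    then have L': "L' \<in> Ob (Rel U n)" "L' \<in> A" by (auto simp: is_cone_def)
    have "\<forall>i\<in>Ob J. \<exists>\<phi>. p' i = (Fo i, \<phi>, L') \<and> relmap (Fo i) \<phi> L'"
    proof
      fix i assume "i \<in> Ob J"
      then have "p' i \<in> Hom ?F (Fo i) L'" using cone by (simp add: is_cone_def)
      then show "\<exists>\<phi>. p' i = (Fo i, \<phi>, L') \<and> relmap (Fo i) \<phi> L'"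
        by (auto dest!: Hom_full_subcategory_subset simp: Hom_Rel)
    qed
    then obtain \<psi> where p': "\<And>i. i \<in> Ob J \<Longrightarrow> p' i = (Fo i, \<psi> i, L')"
      and \<psi>: "\<And>i. i \<in> Ob J \<Longrightarrow> relmap (Fo i) (\<psi> i) L'" by metis
    have compat: "\<psi> (Dom J a) (\<alpha> a x) = \<psi> (Cod J a) x" if "a \<in> Arr J" "x \<in> fst (Fo (Cod J a))" for a x
    proof -
      have "Comp (dual ?F) (Fa a) (p' (Dom J a)) = p' (Cod J a)" using cone that by (simp add: is_cone_def)
      then have "compose (fst (Fo (Cod J a))) (\<psi> (Dom J a)) (\<alpha> a) = \<psi> (Cod J a)"
        using that by (simp add: Fa p' J.Dom_Ob J.Cod_Ob Comp_Rel)
      then show ?thesis using that(2) by (metis compose_eq)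
    qed
    have "((\<lambda>(i, x). \<psi> i x), L') \<in> H"
      using L' \<psi> compat by (auto simp: H_def Z_def relmap_def)
    from ex[OF this] obtain u where u: "relmap L u L'" "\<forall>z\<in>Z. u (e z) = (case z of (i, x) \<Rightarrow> \<psi> i x)"
      by blast
    have Comp_iff: "Comp ?F (L, w, L') (Fo i, \<pi> i, L) = p' i \<longleftrightarrow> (\<forall>x\<in>fst (Fo i). w (e (i, x)) = \<psi> i x)"
      if "i \<in> Ob J" for i w
    proof -
      have "\<psi> i \<in> extensional (fst (Fo i))" using \<psi>[OF that] by (auto simp: relmap_def PiE_def)
      then show ?thesis
        by (auto simp: Comp_Rel p'[OF that] compose_def \<pi>_def fun_eq_iff extensional_def)
    qed
    show "\<exists>!v. v \<in> Hom (dual ?F) L' L \<and> (\<forall>i\<in>Ob J. Comp (dual ?F) (Fo i, \<pi> i, L) v = p' i)"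
    proof (intro ex1I conjI ballI)
      show "(L, u, L') \<in> Hom (dual ?F) L' L" using u(1) L LA L' by (simp add: Hom_Rel)
      show "Comp (dual ?F) (Fo i, \<pi> i, L) (L, u, L') = p' i" if "i \<in> Ob J" for i
        using Comp_iff[OF that] u(2) that by (simp add: Z_def)
    next
      fix v assume v: "v \<in> Hom (dual ?F) L' L \<and> (\<forall>i\<in>Ob J. Comp (dual ?F) (Fo i, \<pi> i, L) v = p' i)"
      then obtain w where w: "v = (L, w, L')" "relmap L w L'"
        by (auto dest!: Hom_full_subcategory_subset simp: Hom_Rel)
      have "w (e z) = u (e z)" if "z \<in> Z" for z
        using v Comp_iff[of _ w] u(2) that by (auto simp: w(1) Z_def)
      then have "w = u"
        using w(2) u(1) fstL by (intro extensionalityI[of _ "fst L"]) (auto simp: relmap_def PiE_def)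
      then show "v = (L, u, L')" by (simp add: w)
    qed
  qed
  then show "\<exists>L p. is_limit J (dual (Inj S (Rel U n))) Fo Fa L p" unfolding Inj by blast
qed

section \<open>Internal relations in the dual of the injective objects\<close>

lemma rel_closed_full:
  assumes "rel_closed S n T" and "X \<subseteq> fst T"
  shows "rel_closed S n (X, tuples n X)"
  unfolding rel_closed_def
proof (intro ballI conjI)
  fix M assume M: "M \<in> S"
  then have "row_closed M 2 (fst T) (\<lambda>t. t 0 = t 1)" using assms by (simp add: rel_closed_def)
  then show "row_closed M 2 (fst (X, tuples n X)) (\<lambda>t. t 0 = t 1)"
    by (rule row_closed_INT_vimage[where H="{()}" and f="\<lambda>_ x. x"]) (use assms(2) in auto)
  show "row_closed M n (fst (X, tuples n X)) (\<lambda>t. vec n t \<in> snd (X, tuples n X))"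
    by (rule row_closedI) (auto simp: tuples_iff Pi_iff)
qed

text \<open>Joint monicity is now tested against injective objects only, so surjectivity onto
  \<open>Q\<close> is not automatic. It holds as soon as some injective object has two points;
  otherwise a single left column already solves the extension problem, which is where nonemptiness
  enters.\<close>

lemma has_closed_relations_dual_Inj:
  fixes U :: "'u set set"
  assumes U: "set_universe U" and MS: "M \<in> S" and nonempty: "dim_col M > 0"
  shows "has_closed_relations (dual (Inj S (Rel U n))) M"
  unfolding has_closed_relations_def
proof (intro allI impI ballI)
  define A where "A = {X. injective_object (Rel U n) S X}"
  have A: "X \<in> A \<longleftrightarrow> X \<in> Ob (Rel U n) \<and> rel_closed S n X" for X
    by (simp add: A_def injective_object_iff[OF U])
  have Inj: "Inj S (Rel U n) = full_subcategory (Rel U n) A" by (simp add: Inj_def A_def)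
  fix B Q r X
  assume rel: "internal_relation (dual (Inj S (Rel U n))) (dim_row M) B Q r"
    and "X \<in> Ob (dual (Inj S (Rel U n)))"
  then have X: "X \<in> Ob (Rel U n) \<inter> A" by (simp add: Inj)
  obtain \<rho> where r: "r = vec (dim_row M) (\<lambda>i. (B, \<rho> i, Q))"
    and \<rho>: "\<And>i. i < dim_row M \<Longrightarrow> relmap B (\<rho> i) Q"
    and B: "B \<in> Ob (Rel U n) \<inter> A" and Q: "Q \<in> Ob (Rel U n) \<inter> A"
    using Rel_internal_relationD[OF rel[unfolded Inj]] by metis
  show "closed_over (dual (Inj S (Rel U n))) M B Q r X"
    unfolding r Inj
  proof (rule closed_over_Rel[OF B Q X \<rho>, THEN iffD2], assumption, intro allI impI)
    fix k f assume k: "0 < (k :: nat)" and M: "M \<in> matr (dim_row M) (dim_col M) k"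
      and f: "\<forall>c<k. relmap B (f c) X"
      and cols: "\<forall>j<dim_col M. \<exists>u. relmap Q u X \<and>
        (\<forall>i<dim_row M. \<forall>b\<in>fst B. u (\<rho> i b) = f (M $$ (i, j)) b)"
    have fX: "f c \<in> fst B \<rightarrow> fst X" if "c < k" for c using f that by (auto simp: relmap_def)
    show "\<exists>u. relmap Q u X \<and> (\<forall>i<dim_row M. \<forall>b\<in>fst B. u (\<rho> i b) = f 0 b)"
    proof (cases "\<exists>T\<in>A. \<exists>x\<in>fst T. \<exists>y\<in>fst T. x \<noteq> y")
      case True
      then obtain T x y where T: "T \<in> A" "x \<in> fst T" "y \<in> fst T" "x \<noteq> y" by blast
      \<comment> \<open>Two points of an injective object, with all tuples on them, form an
        injective object again: equality is inherited and the full relation is closed. This object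
        detects surjectivity.\<close>
      let ?T = "({x, y}, tuples n {x, y})"
      have "fst T \<in> U" using T(1) by (simp add: A Ob_Rel)
      then have "?T \<in> Ob (Rel U n) \<inter> A"
        using rel_closed_full[of S n T "{x, y}"] T set_universe_subset[OF U, of "fst T" "{x, y}"]
        by (simp add: A Ob_Rel)
      then have surj: "fst Q = (\<Union>i<dim_row M. \<rho> i ` fst B)"
        by (intro Rel_internal_relation_surj[OF rel[unfolded r Inj] \<rho>, of "{x, y}" x y]) (use T in auto)
      have "\<exists>u. relmap (fst Q, snd Q) u (fst X, snd X) \<and>
          (\<forall>i<dim_row M. \<forall>b\<in>fst B. u (\<rho> i b) = f 0 b)"
      proof (rule row_closed_extension[OF _ _ k M surj _ fX])
        show "snd Q \<subseteq> tuples n (fst Q)" using Q by (simp add: Ob_Rel)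
        fix j assume "j < dim_col M"
        with cols show "\<exists>u. map_vec u ` snd Q \<subseteq> snd X \<and>
            (\<forall>i<dim_row M. \<forall>b\<in>fst B. u (\<rho> i b) = f (M $$ (i, j)) b)"
          unfolding relmap_def by blast
      qed (use X MS in \<open>auto simp: A rel_closed_def\<close>)
      then show ?thesis by simp
    next
      case False
      \<comment> \<open>Since \<open>X\<close> has at most one point, the morphism for column 0 also
        has the values prescribed by \<open>f 0\<close>.\<close>
      from cols nonempty obtain u where u: "relmap Q u X"
        "\<forall>i<dim_row M. \<forall>b\<in>fst B. u (\<rho> i b) = f (M $$ (i, 0)) b" by blast
      have "f (M $$ (i, 0)) b = f 0 b" if "i < dim_row M" "b \<in> fst B" for i b
        using fX[OF matr_entry[OF M that(1) nonempty]] fX[OF k] that(2) False X by blast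
      with u show ?thesis by auto
    qed
  qed
qed

section \<open>The generic n-ary relation\<close>

text \<open>Maps from \<open>B\<close> to \<open>P\<close> are the points of \<open>P\<close>, maps
  from \<open>Q\<close> to \<open>P\<close> are its related tuples, and composition with
  \<open>\<rho> i\<close> takes the coordinate \<open>i\<close>. Hence what the generic relation
  satisfies over \<open>P\<close> is a statement about \<open>R\<close> over
  \<open>Y\<close>.\<close>

lemma has_closed_relations_from_Inj:
  fixes U :: "'u set set" and C :: "('o, 'm) cat"
  assumes U: "set_universe U" and N: "dim_row N = n"
    and InjN: "has_closed_relations (dual (Inj S (Rel U n))) N"
    and C: "C \<in> mclex S"
  shows "has_closed_relations C N"
  unfolding has_closed_relations_def
proof (intro allI impI ballI)
  define I where "I = {X. injective_object (Rel U n) S X}"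
  have I: "X \<in> I \<longleftrightarrow> X \<in> Ob (Rel U n) \<and> rel_closed S n X" for X
    by (simp add: I_def injective_object_iff[OF U])
  have Inj: "Inj S (Rel U n) = full_subcategory (Rel U n) I" by (simp add: Inj_def I_def)
  have fc: "finitely_complete C" and CS: "\<And>M. M \<in> S \<Longrightarrow> has_closed_relations C M"
    using C by (auto simp: mclex_def)
  fix A R r Y
  assume "internal_relation C (dim_row N) A R r" and Y: "Y \<in> Ob C"
  then have r: "internal_relation C n A R r" by (simp add: N)
  then have A: "A \<in> Ob C" and dim: "dim_vec r = dim_row N" by (auto simp: internal_relation_def N)
  obtain g :: "nat \<Rightarrow> 'u" where g: "inj g" "\<And>A. g ` A \<in> U" using set_universe_nat[OF U] by metis
  show "closed_over C N A R r Y"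
    unfolding closed_over_iff[OF dim]
  proof (intro allI ballI impI)
    fix k :: nat and f
    assume k: "0 < k" and f: "f \<in> {..<k} \<rightarrow> Hom C Y A" and Nk: "N \<in> matr (dim_row N) (dim_col N) k"
      and cols: "\<forall>j<dim_col N. \<exists>u\<in>Hom C Y R. \<forall>i<dim_row N. Comp C (r $ i) u = f (N $$ (i, j))"
    \<comment> \<open>Only the finitely many morphisms in the image of \<open>f\<close> are coded,
      by way of the natural numbers, since the type \<open>'m\<close> is unrelated to the
      universe.\<close>
    obtain \<kappa>' :: "'m \<Rightarrow> nat" where \<kappa>': "inj_on \<kappa>' (f ` {..<k})"
      using finite_imp_inj_to_nat_seg[of "f ` {..<k}"] by auto
    define \<iota> where "\<iota> = g \<circ> \<kappa>'"
    have \<iota>: "inj_on \<iota> (f ` {..<k})"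
      unfolding \<iota>_def by (intro comp_inj_on \<kappa>' inj_on_subset[OF g(1)]) auto
    define F where "F = \<iota> ` f ` {..<k}"
    define \<kappa> where "\<kappa> = inv_into (f ` {..<k}) \<iota>"
    have \<kappa>\<iota>: "\<kappa> (\<iota> (f c)) = f c" if "c < k" for c using \<iota> that by (simp add: \<kappa>_def)
    have \<iota>F: "\<iota> (f c) \<in> F" if "c < k" for c using that by (simp add: F_def)
    have \<kappa>: "\<kappa> \<in> F \<rightarrow> Hom C Y A" using f \<kappa>\<iota> by (auto simp: F_def)
    have \<kappa>_inj: "\<kappa> x = \<kappa> y \<longleftrightarrow> x = y" if "x \<in> F" "y \<in> F" for x y
      using that \<kappa>\<iota> by (auto simp: F_def)
    \<comment> \<open>The relation that \<open>R\<close> induces over \<open>Y\<close>, read through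
      the decoding \<open>\<kappa>\<close>. Injectivity of \<open>\<kappa>\<close> on
      \<open>F\<close> makes equality in \<open>P\<close> the pullback of equality of
      morphisms.\<close>
    define P where "P = (F, {t \<in> tuples n F. \<exists>u\<in>Hom C Y R. \<forall>l<n. Comp C (r $ l) u = \<kappa> (t $ l)})"
    have "F \<in> U" using g(2)[of "\<kappa>' ` f ` {..<k}"] by (simp add: F_def \<iota>_def image_comp)
    then have "P \<in> Ob (Rel U n)" by (auto simp: Ob_Rel P_def)
    moreover have "rel_closed S n P"
      unfolding rel_closed_def
    proof (intro ballI conjI)
      fix M assume M: "M \<in> S"
      show "row_closed M 2 (fst P) (\<lambda>t. t 0 = t 1)"
        by (rule row_closed_INT_vimage[where H="{()}" and f="\<lambda>_. \<kappa>",
              OF row_closed_Hom_eq[OF fc CS[OF M] A Y]])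
          (use \<kappa> \<kappa>_inj in \<open>auto simp: P_def Pi_iff\<close>)
      show "row_closed M n (fst P) (\<lambda>t. vec n t \<in> snd P)"
        by (rule row_closed_INT_vimage[where H="{()}" and f="\<lambda>_. \<kappa>",
              OF closed_relation_row_closed[OF fc CS[OF M] r Y]])
          (use \<kappa> in \<open>auto simp: P_def tuples_iff Pi_iff\<close>)
    qed
    ultimately have PI: "P \<in> I" by (simp add: I)
    have fin: "X \<lesssim> range g" if "finite X" for X :: "nat set"
      using finite_lepoll_infinite[OF _ that] range_inj_infinite[OF g(1)] by blast
    \<comment> \<open>\<open>B\<close> and \<open>Q\<close> represent the functors sending an object of \<open>Inj S (Rel U n)\<close> to its underlying
      set and to its relation.\<close>
    define HB where "HB = {(h, X :: 'u rel_ob). X \<in> I \<and> h \<in> {0 :: nat} \<rightarrow> fst X}"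
    define HQ where "HQ = {(h, X :: 'u rel_ob). X \<in> I \<and> h \<in> {..<n} \<rightarrow> fst X \<and> vec n h \<in> snd X}"
    obtain eB B where B: "B \<in> Ob (Rel U n)" "rel_closed S n B" and fstB: "fst B = eB ` {0}"
      and exB: "\<And>h X. (h, X) \<in> HB \<Longrightarrow> \<exists>u. relmap B u X \<and> (\<forall>z\<in>{0}. u (eB z) = h z)"
    proof (rule rel_quotient[OF U g(2)[of UNIV] fin, of "{0}" HB S n])
      show "h \<in> {0} \<rightarrow> fst X \<and> rel_closed S n X" if "(h, X) \<in> HB" for h X
        using that by (simp add: HB_def I)
    qed (simp, rule that)
    obtain eQ Q where Q: "Q \<in> Ob (Rel U n)" "rel_closed S n Q" and fstQ: "fst Q = eQ ` {..<n}"
      and eQ: "\<And>t. t \<in> tuples n {..<n} \<Longrightarrow> map_vec eQ t \<in> snd Q \<longleftrightarrow> (\<forall>(h, X)\<in>HQ. map_vec h t \<in> snd X)"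
      and exQ: "\<And>h X. (h, X) \<in> HQ \<Longrightarrow> \<exists>u. relmap Q u X \<and> (\<forall>z\<in>{..<n}. u (eQ z) = h z)"
    proof (rule rel_quotient[OF U g(2)[of UNIV] fin, of "{..<n}" HQ S n])
      show "h \<in> {..<n} \<rightarrow> fst X \<and> rel_closed S n X" if "(h, X) \<in> HQ" for h X
        using that by (simp add: HQ_def I)
    qed (simp, rule that)
    have BI: "B \<in> Ob (Rel U n) \<inter> I" and QI: "Q \<in> Ob (Rel U n) \<inter> I" and PI': "P \<in> Ob (Rel U n) \<inter> I"
      using B Q PI I by auto
    have point: "\<exists>u. relmap B u X \<and> u (eB 0) = x" if "X \<in> I" "x \<in> fst X" for X x
      using exB[of "\<lambda>_. x" X] that by (auto simp: HB_def)
    have "\<forall>i<n. \<exists>u. relmap B u Q \<and> u (eB 0) = eQ i" using point QI fstQ by auto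
    then obtain \<rho> where \<rho>: "\<And>i. i < n \<Longrightarrow> relmap B (\<rho> i) Q" "\<And>i. i < n \<Longrightarrow> \<rho> i (eB 0) = eQ i"
      by metis
    have "\<forall>c<k. \<exists>u. relmap B u P \<and> u (eB 0) = \<iota> (f c)" using point PI \<iota>F by (auto simp: P_def)
    then obtain \<phi> where \<phi>: "\<And>c. c < k \<Longrightarrow> relmap B (\<phi> c) P" "\<And>c. c < k \<Longrightarrow> \<phi> c (eB 0) = \<iota> (f c)"
      by metis
    have \<rho>N: "relmap B (\<rho> i) Q" if "i < dim_row N" for i using \<rho>(1) that N by simp
    \<comment> \<open>The points \<open>eQ i\<close> are all the points of \<open>Q\<close>, so the
      maps \<open>\<rho> i\<close> are jointly surjective.\<close>
    have "internal_relation (dual (full_subcategory (Rel U n) I)) (dim_row N) B Q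
        (vec (dim_row N) (\<lambda>i. (B, \<rho> i, Q)))"
      by (rule Rel_internal_relationI[OF BI QI \<rho>N]) (use fstB fstQ \<rho>(2) N in auto)
    then have clo: "closed_over (dual (full_subcategory (Rel U n) I)) N B Q
        (vec (dim_row N) (\<lambda>i. (B, \<rho> i, Q))) P"
      using InjN PI' unfolding Inj has_closed_relations_def dual_simps full_subcategory_simps by blast
    have "\<exists>u. relmap Q u P \<and> (\<forall>i<dim_row N. \<forall>b\<in>fst B. u (\<rho> i b) = \<phi> 0 b)"
    proof (rule closed_over_Rel[OF BI QI PI' \<rho>N, THEN iffD1, OF _ clo, rule_format, OF _ k Nk])
      fix j assume j: "j < dim_col N"
      have Nij: "N $$ (i, j) < k" if "i < n" for i using matr_entry[OF Nk] N that j by simp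
      have "\<exists>u\<in>Hom C Y R. \<forall>l<n. Comp C (r $ l) u = f (N $$ (l, j))" using cols j N by blast
      \<comment> \<open>The \<open>j\<close>-th left column belongs to \<open>R\<close>, so its code
        is a related tuple of \<open>P\<close> and is named by a map out of
        \<open>Q\<close>.\<close>
      then have "((\<lambda>i. \<iota> (f (N $$ (i, j)))), P) \<in> HQ"
        using PI Nij \<iota>F \<kappa>\<iota> by (auto simp: HQ_def P_def tuples_iff)
      from exQ[OF this] obtain u where u: "relmap Q u P" "\<And>i. i < n \<Longrightarrow> u (eQ i) = \<iota> (f (N $$ (i, j)))"
        by auto
      then have "\<forall>i<dim_row N. \<forall>b\<in>fst B. u (\<rho> i b) = \<phi> (N $$ (i, j)) b"
        using N \<rho>(2) \<phi>(2) Nij by (simp add: fstB)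
      with u(1) show "\<exists>u. relmap Q u P \<and> (\<forall>i<dim_row N. \<forall>b\<in>fst B. u (\<rho> i b) = \<phi> (N $$ (i, j)) b)"
        by blast
    qed (use \<phi> in auto)
    then obtain u where u: "relmap Q u P" "\<And>i. i < n \<Longrightarrow> u (eQ i) = \<iota> (f 0)"
      using N \<rho>(2) \<phi>(2)[OF k] by (auto simp: fstB)
    \<comment> \<open>The generic tuple is related in \<open>Q\<close> because every
      \<open>h\<close> occurring in \<open>HQ\<close> sends the tuple of all indices to a related
      tuple. Its image under \<open>u\<close> is the code of the right column.\<close>
    have "map_vec eQ (vec n id) \<in> snd Q"
    proof (subst eQ)
      show "\<forall>(h, X)\<in>HQ. map_vec h (vec n id) \<in> snd X"
      proof (clarify)
        fix h X V assume "(h, X, V) \<in> HQ"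
        moreover have "map_vec h (vec n id) = vec n h" by auto
        ultimately show "map_vec h (vec n id) \<in> snd (X, V)" by (auto simp: HQ_def)
      qed
    qed (auto simp: tuples_iff)
    then have "map_vec u (map_vec eQ (vec n id)) \<in> snd P" using u(1) by (auto simp: relmap_def)
    moreover have "map_vec u (map_vec eQ (vec n id)) = vec n (\<lambda>_. \<iota> (f 0))" using u(2) by auto
    ultimately have "vec n (\<lambda>_. \<iota> (f 0)) \<in> snd P" by simp
    then show "\<exists>u\<in>Hom C Y R. \<forall>i<dim_row N. Comp C (r $ i) u = f 0"
      using \<kappa>\<iota>[OF k] by (auto simp: P_def N)
  qed
qed

theorem theorem3p4:
  fixes U :: "'u set set" and S :: "nat mat set" and N :: "nat mat" and n m k :: nat
  assumes "set_universe U"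
    and "Ob (Rel U n) \<lesssim> (UNIV :: 'o set)"
    and "Arr (Rel U n) \<lesssim> (UNIV :: 'm set)"
    and "matrix_set S"
    and "\<forall>M\<in>S. \<not> empty_matrix M"
    and "n > 0" and "k > 0" and "N \<in> matr n m k"
  shows "dual (Inj S (Rel U n)) \<in> mclex S \<and>
    ((mclex S :: ('o, 'm) cat set) \<subseteq> mclex {N} \<longleftrightarrow> dual (Inj S (Rel U n)) \<in> mclex {N})"
proof (intro conjI iffI subsetI)
  let ?D = "dual (Inj S (Rel U n))"
  show D: "?D \<in> mclex S"
    using finitely_complete_dual_Inj[OF assms(1)] has_closed_relations_dual_Inj[OF assms(1)] assms(5)
    by (auto simp: mclex_def empty_matrix_def)
  {
    assume sub: "(mclex S :: ('o, 'm) cat set) \<subseteq> mclex {N}"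
    \<comment> \<open>The inclusion speaks of categories on the types \<open>'o\<close> and
      \<open>'m\<close> only. The size bounds provide a copy of \<open>?D\<close> there, and
      membership in \<open>mclex\<close> travels along the isomorphism in both directions.\<close>
    have "category ?D" using D by (simp add: mclex_def finitely_complete_def)
    moreover have "Ob ?D \<lesssim> (UNIV :: 'o set)" "Arr ?D \<lesssim> (UNIV :: 'm set)"
      using assms(2,3)
      by (auto simp: Inj_def full_subcategory_def intro: lepoll_trans[OF subset_imp_lepoll])
    ultimately obtain K :: "('o, 'm) cat" and g h g' h' where iso: "cat_iso ?D K g h g' h'"
      using ex_cat_iso by metis
    then have "K \<in> mclex S" using D by (rule cat_iso.mclex_map)
    then have "K \<in> mclex {N}" using sub by blast
    then show "?D \<in> mclex {N}" using cat_iso.mclex_map[OF cat_iso.inverse[OF iso]] by blast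
  next
    fix C :: "('o, 'm) cat" assume "?D \<in> mclex {N}" and C: "C \<in> mclex S"
    then have "has_closed_relations ?D N" by (simp add: mclex_def)
    moreover have "dim_row N = n" using assms(8) by (auto simp: matr_def)
    ultimately show "C \<in> mclex {N}"
      using has_closed_relations_from_Inj[OF assms(1) _ _ C] C by (simp add: mclex_def)
  }
qed

end
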